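(* Let $A\in\mathbb{R}^{n\times n}$ be neutrally stable and $C\in\mathbb{R}^{m\times n}$ be such that $(C,A)$ is detectable. Let $L\in\mathbb{R}^{n\times m}$ be any matrix constructed from $(A,C)$ according to the Algorithm described in the context. Let $p\ge 1$ and let $\Lambda=[\lambda_{ij}]\in\mathbb{R}^{p\times p}$ be any connected matrix (in the discrete-time sense). Consider the $p$ coupled systems $$x_i(k+1)=Ax_i(k)+u_i(k),\qquad y_i(k)=Cx_i(k),\qquad u_i(k)=Lz_i(k),\qquad z_i(k)=\sum_{j=1}^{p}\lambda_{ij}\big(y_j(k)-y_i(k)\big),$$ for $i=1,\dots,p$ and $k\in\mathbb{N}$, with arbitrary initial conditions $x_1(0),\dots,x_p(0)\in\mathbb{R}^n$. Let $r\in\mathbb{R}^p$ be such that $r^T\Lambda=r^T$ and $r^T\mathbf{1}=1$. Then the solutions $x_i(\cdot)$, $i=1,\dots,p$, synchronize to $$\bar x(k):=(r^T\otimes A^k)\begin{bmatrix}x_1(0)\\ \vdots\\ x_p(0)\end{bmatrix},$$ that is, $|x_i(k)-\bar x(k)|\to 0$ as $k\to\infty$ for every $i\in\{1,\dots,p\}$.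
   Context: $\mathbb{N}$ is the set of nonnegative integers, $|\cdot|$ is the 2-norm, $\otimes$ is the Kronecker product, and $\mathbf{1}\in\mathbb{R}^p$ is the vector with all entries equal to 1. Neutrally stable: $A\in\mathbb{R}^{n\times n}$ is neutrally stable (discrete-time sense) if it has no eigenvalue of magnitude greater than one and every Jordan block corresponding to an eigenvalue $\lambda$ with $|\lambda|=1$ is of size one. Detectable: $(C,A)$ is detectable (discrete-time sense) if, for $x\in\mathbb{R}^n$, $CA^kx=0$ for all $k\in\mathbb{N}$ implies $\lim_{k\to\infty}A^kx=0$. Connected matrix: the graph of $\Lambda=[\lambda_{ij}]\in\mathbb{R}^{p\times p}$ is the directed graph with nodes $n_1,\dots,n_p$ in which $(n_i,n_j)$ is an arc iff $\lambda_{ij}>0$. A path from $n_{i_1}$ to $n_{i_\ell}$ is a sequence of nodes $n_{i_1},\dots,n_{i_\ell}$ whose consecutive pairs $(n_{i_s},n_{i_{s+1}})$ are arcs. A directed graph is connected if it has a node to which there exists a path from every other node. $\Lambda$ is connected (discrete-time sense) if (i) $\lambda_{ii}>0$ and $\lambda_{ij}\ge 0$ for all $i,j$; (ii) each row of $\Lambda$ sums to 1; (iii) its graph is connected. Algorithm (construction of $L$ from $A$ and $C$, with $A$ neutrally stable): let $n_1\le n$ be the number of eigenvalues of $A$ of magnitude one (counted with multiplicity) and $n_2:=n-n_1$. If $n_1=0$, let $L:=0$. Otherwise: Step 1: choose $U\in\mathbb{R}^{n\times n_1}$ and $W\in\mathbb{R}^{n\times n_2}$ such that $[U\ W]$ is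 invertible and $$[U\ W]^{-1}A[U\ W]=\begin{bmatrix}F&0\\0&G\end{bmatrix},$$ where all the eigenvalues of $F\in\mathbb{R}^{n_1\times n_1}$ have magnitude one (so all eigenvalues of $G\in\mathbb{R}^{n_2\times n_2}$ have magnitude less than one). It is assumed that $CU$ has full row rank. Step 2: choose a symmetric positive definite $R\in\mathbb{R}^{n_1\times n_1}$ such that $F^TRF=R$ (such $R$ exists). Step 3: choose $H\in\mathbb{R}^{m\times n_1}$ satisfying $\mathrm{range}(H^T)=\mathrm{range}(R^{-1/2}U^TC^T)$ and $HH^T=I_m$ (then $CUR^{-1/2}H^T$ is invertible). Step 4: define $L:=UFR^{-1/2}H^T(CUR^{-1/2}H^T)^{-1}$. *)

theory Defs
  imports
    "Jordan_Normal_Form.Spectral_Radius"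
    "Jordan_Normal_Form.Gauss_Jordan_Elimination"
    "Jordan_Normal_Form.DL_Rank"
begin

text \<open>
  The block sizes of the construction below depend on the spectrum of the given matrix, so
  matrices and vectors are carrier-based (\<open>carrier_mat\<close>, \<open>carrier_vec\<close>).  All indices are
  0-based.
\<close>

definition norm2 :: "real vec \<Rightarrow> real" where
  "norm2 v = sqrt (v \<bullet> v)"

definition ones_vec :: "nat \<Rightarrow> real vec" where
  "ones_vec p = vec p (\<lambda>_. 1)"

abbreviation cmat :: "real mat \<Rightarrow> complex mat" where
  "cmat A \<equiv> map_mat complex_of_real A"

text \<open>Only applied to matrices that are invertible; otherwise the value is unspecified.\<close>

definition mat_inv :: "real mat \<Rightarrow> real mat" where
  "mat_inv A = the (mat_inverse A)"

definition append_cols :: "real mat \<Rightarrow> real mat \<Rightarrow> real mat" where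
  "append_cols U W = four_block_mat U W (0\<^sub>m 0 (dim_col U)) (0\<^sub>m 0 (dim_col W))"

definition kronecker :: "real mat \<Rightarrow> real mat \<Rightarrow> real mat" where
  "kronecker A B = mat (dim_row A * dim_row B) (dim_col A * dim_col B)
     (\<lambda>(i, j). A $$ (i div dim_row B, j div dim_col B) * B $$ (i mod dim_row B, j mod dim_col B))"

definition stack_vec :: "nat \<Rightarrow> nat \<Rightarrow> (nat \<Rightarrow> real vec) \<Rightarrow> real vec" where
  "stack_vec p n v = vec (p * n) (\<lambda>l. v (l div n) $ (l mod n))"

text \<open>In \<open>jordan_nf\<close>, a pair \<open>(s, \<mu>)\<close> stands for a Jordan block of size \<open>s\<close> for \<open>\<mu>\<close>; the blocks
  are unique up to their order, so the choice of Jordan form does not matter.\<close>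

definition neutrally_stable :: "real mat \<Rightarrow> bool" where
  "neutrally_stable A \<longleftrightarrow>
     (\<forall>\<mu>. eigenvalue (cmat A) \<mu> \<longrightarrow> cmod \<mu> \<le> 1) \<and>
     (\<exists>blocks. jordan_nf (cmat A) blocks \<and>
        (\<forall>(s, \<mu>) \<in> set blocks. cmod \<mu> = 1 \<longrightarrow> s = 1))"

definition detectable :: "nat \<Rightarrow> nat \<Rightarrow> real mat \<Rightarrow> real mat \<Rightarrow> bool" where
  "detectable n m C A \<longleftrightarrow>
     (\<forall>x \<in> carrier_vec n.
        (\<forall>k. (C * A ^\<^sub>m k) *\<^sub>v x = 0\<^sub>v m) \<longrightarrow> (\<lambda>k. norm2 (A ^\<^sub>m k *\<^sub>v x)) \<longlonglongrightarrow> 0)"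

definition graph_arcs :: "nat \<Rightarrow> real mat \<Rightarrow> (nat \<times> nat) set" where
  "graph_arcs p \<Lambda> = {(i, j). i < p \<and> j < p \<and> \<Lambda> $$ (i, j) > 0}"

definition connected_matrix :: "nat \<Rightarrow> real mat \<Rightarrow> bool" where
  "connected_matrix p \<Lambda> \<longleftrightarrow>
     (\<forall>i<p. \<Lambda> $$ (i, i) > 0) \<and>
     (\<forall>i<p. \<forall>j<p. \<Lambda> $$ (i, j) \<ge> 0) \<and>
     (\<forall>i<p. (\<Sum>j<p. \<Lambda> $$ (i, j)) = 1) \<and>
     (\<exists>j<p. \<forall>i<p. (i, j) \<in> (graph_arcs p \<Lambda>)\<^sup>*)"

definition num_unit_eigenvalues :: "real mat \<Rightarrow> nat" where
  "num_unit_eigenvalues A =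
     (\<Sum>\<mu> \<in> {\<mu> \<in> spectrum (cmat A). cmod \<mu> = 1}. Polynomial.order \<mu> (char_poly (cmat A)))"

definition sym_pos_def :: "nat \<Rightarrow> real mat \<Rightarrow> bool" where
  "sym_pos_def n R \<longleftrightarrow>
     R \<in> carrier_mat n n \<and> R\<^sup>T = R \<and>
     (\<forall>v \<in> carrier_vec n. v \<noteq> 0\<^sub>v n \<longrightarrow> v \<bullet> (R *\<^sub>v v) > 0)"

text \<open>\<open>Q\<close> is the symmetric positive definite square root of \<open>R\<close>, which exists and is unique for
  symmetric positive definite \<open>R\<close>.\<close>

definition is_spd_sqrt :: "nat \<Rightarrow> real mat \<Rightarrow> real mat \<Rightarrow> bool" where
  "is_spd_sqrt n R Q \<longleftrightarrow> sym_pos_def n Q \<and> Q * Q = R"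

text \<open>\<open>S\<close> is $R^{-1/2}$.  That the eigenvalues of \<open>G\<close> lie in the open unit disc follows from the
  size of \<open>F\<close> (for neutrally stable \<open>A\<close>), hence is not listed.\<close>

definition sync_gain :: "nat \<Rightarrow> nat \<Rightarrow> real mat \<Rightarrow> real mat \<Rightarrow> real mat \<Rightarrow> bool" where
  "sync_gain n m A C L \<longleftrightarrow>
     (let n1 = num_unit_eigenvalues A; n2 = n - n1 in
      if n1 = 0 then L = 0\<^sub>m n m
      else (\<exists>U \<in> carrier_mat n n1. \<exists>W \<in> carrier_mat n n2.
            \<exists>F \<in> carrier_mat n1 n1. \<exists>G \<in> carrier_mat n2 n2.
            \<exists>R Q S. \<exists>H \<in> carrier_mat m n1.
              invertible_mat (append_cols U W) \<and>
              mat_inv (append_cols U W) * A * append_cols U W =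
                four_block_mat F (0\<^sub>m n1 n2) (0\<^sub>m n2 n1) G \<and>
              (\<forall>\<mu> \<in> spectrum (cmat F). cmod \<mu> = 1) \<and>
              vec_space.rank m (C * U) = m \<and>
              sym_pos_def n1 R \<and> F\<^sup>T * R * F = R \<and>
              is_spd_sqrt n1 R Q \<and> S = mat_inv Q \<and>
              vec_space.col_space n1 (H\<^sup>T) = vec_space.col_space n1 (S * U\<^sup>T * C\<^sup>T) \<and>
              H * H\<^sup>T = 1\<^sub>m m \<and>
              L = U * F * S * H\<^sup>T * mat_inv (C * U * S * H\<^sup>T)))"

end

theory Submission
  imports Defs
begin

text \<open>
  Let \<open>E(k)\<close> be the matrix whose columns are the errors \<open>x\<^sub>i(k) - \<Sum>\<^sub>j r\<^sub>j x\<^sub>j(k)\<close>.  Then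
  \<open>E(k+1) = (A - L C) E(k) + L C E(k) N\<close> with \<open>N = (\<Lambda> - 1 r\<^sup>T)\<^sup>T\<close>, and all eigenvalues \<open>\<nu>\<close> of \<open>N\<close> lie
  in the open unit disc by a maximum modulus argument along the graph.  Triangularizing \<open>N\<close> turns
  the recurrence into a cascade of systems with matrices \<open>A - (1 - \<nu>) L C\<close>, each driven by the
  vanishing states of the preceding ones, so it remains to see that these matrices are Schur
  stable.  On the invariant subspace of the unit eigenvalues, in coordinates scaled by the square
  root of \<open>R\<close>, such a matrix is \<open>\<Phi> (I - (1 - \<nu>) H\<^sup>T H)\<close> with \<open>\<Phi>\<close> orthogonal and \<open>H\<^sup>T H\<close> an orthogonal
  projection; an eigenvector for an eigenvalue outside the open unit disc is therefore killed by
  \<open>H\<close>, hence by \<open>C\<close>, contradicting detectability.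
\<close>

section \<open>Linear recurrences with vanishing input\<close>

lemma mult_mat_left_cancel:
  fixes P Q X :: "'a :: comm_ring_1 mat"
  assumes "Q \<in> carrier_mat n m" "P \<in> carrier_mat m n" "X \<in> carrier_mat n q" "Q * P = 1\<^sub>m n"
  shows "Q * (P * X) = X"
  using assms assoc_mult_mat[of Q n m P n X q] by simp

lemma mult_mat_vec_left_cancel:
  fixes P Q :: "'a :: comm_ring_1 mat"
  assumes "Q \<in> carrier_mat n m" "P \<in> carrier_mat m n" "v \<in> carrier_vec n" "Q * P = 1\<^sub>m n"
  shows "Q *\<^sub>v (P *\<^sub>v v) = v"
  using assms assoc_mult_mat_vec[of Q n m P n v] by simp

lemma smult_mat_mult_vec:
  fixes B :: "'a :: comm_ring_1 mat"
  assumes "B \<in> carrier_mat n m" "v \<in> carrier_vec m"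
  shows "(c \<cdot>\<^sub>m B) *\<^sub>v v = c \<cdot>\<^sub>v (B *\<^sub>v v)"
  using assms by (intro eq_vecI) (auto simp: scalar_prod_def sum_distrib_left ac_simps)

lemma contracting_recurrence_tendsto_0:
  fixes a d :: "nat \<Rightarrow> real"
  assumes \<beta>: "0 \<le> \<beta>" "\<beta> < 1" and a: "\<And>k. 0 \<le> a k"
    and step: "\<And>k. a (Suc k) \<le> \<beta> * a k + d k" and d: "d \<longlonglongrightarrow> 0"
  shows "a \<longlonglongrightarrow> 0"
proof (rule LIMSEQ_I)
  fix e :: real assume e: "0 < e"
  \<comment> \<open>With this choice \<open>e / 2\<close> is the fixed point of the affine map with
    slope \<open>\<beta>\<close> and offset \<open>\<eta>\<close>. Once the input stays below
    \<open>\<eta>\<close>, the excess of \<open>a\<close> over \<open>e / 2\<close> therefore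
    shrinks at least geometrically.\<close>
  define \<eta> where "\<eta> = e / 2 * (1 - \<beta>)"
  have "\<eta> > 0" using e \<beta> by (simp add: \<eta>_def)
  then obtain K where K: "\<And>k. k \<ge> K \<Longrightarrow> \<bar>d k\<bar> < \<eta>"
    using LIMSEQ_D[OF d, of \<eta>] by auto
  have bound: "a (K + j) \<le> \<beta> ^ j * a K + e / 2" for j
  proof (induction j)
    case (Suc j)
    have "a (K + Suc j) \<le> \<beta> * a (K + j) + \<eta>"
      using step[of "K + j"] K[of "K + j"] by simp
    also have "\<dots> \<le> \<beta> * (\<beta> ^ j * a K + e / 2) + \<eta>"
      using Suc \<beta> by (simp add: mult_left_mono)
    also have "\<dots> = \<beta> ^ Suc j * a K + e / 2"
      by (simp add: \<eta>_def field_simps)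
    finally show ?case .
  qed (use e in simp)
  have "(\<lambda>j. \<beta> ^ j * a K) \<longlonglongrightarrow> 0"
    using tendsto_mult_left_zero[OF LIMSEQ_power_zero[of \<beta>]] \<beta> by simp
  then have "\<forall>\<^sub>F j in sequentially. \<beta> ^ j * a K < e / 2"
    by (rule order_tendstoD) (use e in simp)
  then obtain J where J: "\<And>j. j \<ge> J \<Longrightarrow> \<beta> ^ j * a K < e / 2"
    unfolding eventually_sequentially by blast
  have "norm (a k - 0) < e" if "k \<ge> K + J" for k
  proof -
    have "J \<le> k - K" "K + (k - K) = k" using that by auto
    then show ?thesis using bound[of "k - K"] J[of "k - K"] a[of k] by simp
  qed
  then show "\<exists>N. \<forall>k\<ge>N. norm (a k - 0) < e" by blast
qed

text \<open>Back substitution: coordinate \<open>i\<close> obeys a scalar recurrence with factor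
  \<open>B $$ (i, i)\<close>, driven by \<open>d\<close> and by the coordinates after
  \<open>i\<close>. The induction on \<open>n - i\<close> starts from the last coordinate, so this
  whole input already tends to zero.\<close>

lemma upper_triangular_recurrence_tendsto_0:
  fixes B :: "complex mat" and s d :: "nat \<Rightarrow> complex vec"
  assumes B: "B \<in> carrier_mat n n" "upper_triangular B"
    and diag: "\<And>i. i < n \<Longrightarrow> cmod (B $$ (i, i)) < 1"
    and s: "\<And>k. s k \<in> carrier_vec n" and d: "\<And>k. d k \<in> carrier_vec n"
    and step: "\<And>k. s (Suc k) = B *\<^sub>v s k + d k"
    and d_lim: "\<And>i. i < n \<Longrightarrow> (\<lambda>k. d k $ i) \<longlonglongrightarrow> 0"
    and i: "i < n"
  shows "(\<lambda>k. s k $ i) \<longlonglongrightarrow> 0"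
  using i
proof (induction "n - i" arbitrary: i rule: less_induct)
  case less
  note i = \<open>i < n\<close>
  define g where "g k = (\<Sum>j\<in>{Suc i..<n}. B $$ (i, j) * s k $ j) + d k $ i" for k
  have "g \<longlonglongrightarrow> (\<Sum>j\<in>{Suc i..<n}. B $$ (i, j) * 0) + 0"
    unfolding g_def by (intro tendsto_intros less.hyps d_lim) (use i in auto)
  then have g: "(\<lambda>k. cmod (g k)) \<longlonglongrightarrow> 0" using tendsto_norm_zero by force
  have "s (Suc k) $ i = B $$ (i, i) * s k $ i + g k" for k
  proof -
    have "s (Suc k) $ i = (\<Sum>j = 0..<n. B $$ (i, j) * s k $ j) + d k $ i"
      using B(1) s[of k] d[of k] i by (simp add: step scalar_prod_def)
    also have "(\<Sum>j = 0..<n. B $$ (i, j) * s k $ j) = (\<Sum>j = i..<n. B $$ (i, j) * s k $ j)"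
      by (rule sum.mono_neutral_right) (use B i in \<open>auto simp: upper_triangular_def\<close>)
    also have "\<dots> = B $$ (i, i) * s k $ i + (\<Sum>j = Suc i..<n. B $$ (i, j) * s k $ j)"
      using i by (simp add: sum.atLeast_Suc_lessThan)
    finally show ?thesis by (simp add: g_def)
  qed
  then have "cmod (s (Suc k) $ i) \<le> cmod (B $$ (i, i)) * cmod (s k $ i) + cmod (g k)" for k
    by (metis norm_mult norm_triangle_ineq)
  then have "(\<lambda>k. cmod (s k $ i)) \<longlonglongrightarrow> 0"
    using g diag[OF i]
    by (rule_tac contracting_recurrence_tendsto_0[where \<beta> = "cmod (B $$ (i, i))" and d = "\<lambda>k. cmod (g k)"]) auto
  then show ?case by (rule tendsto_norm_zero_cancel)
qed

text \<open>The characteristic polynomial splits over the complex numbers, and the Schur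
  decomposition places its roots on the diagonal of \<open>D\<close>.\<close>

lemma complex_schur_triangularization:
  fixes N :: "complex mat"
  assumes N: "N \<in> carrier_mat n n"
  obtains D P Q where "D \<in> carrier_mat n n" "P \<in> carrier_mat n n" "Q \<in> carrier_mat n n"
    "P * Q = 1\<^sub>m n" "Q * P = 1\<^sub>m n" "N = P * D * Q" "upper_triangular D"
    "\<And>i. i < n \<Longrightarrow> eigenvalue N (D $$ (i, i))"
proof -
  obtain es where es: "char_poly N = (\<Prod>e\<leftarrow>es. [:- e, 1:])" using char_poly_factorized[OF N] by blast
  obtain D P Q where dec: "schur_decomposition N es = (D, P, Q)" by (metis prod_cases3)
  from schur_decomposition[OF N es dec]
  have w: "similar_mat_wit N D P Q" and ut: "upper_triangular D" and diag: "diag_mat D = es" by auto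
  note W = similar_mat_witD2[OF N w]
  have "eigenvalue N (D $$ (i, i))" if "i < n" for i
  proof -
    have "D $$ (i, i) \<in> set es" using that W(5) diag[symmetric] by (simp add: diag_mat_def)
    then show ?thesis
      unfolding eigenvalue_root_char_poly[OF N] es by (simp add: poly_prod_list prod_list_zero_iff image_iff)
  qed
  with W ut that show thesis by blast
qed

definition schur_stable :: "complex mat \<Rightarrow> bool" where
  "schur_stable M \<longleftrightarrow> (\<forall>\<mu>. eigenvalue M \<mu> \<longrightarrow> cmod \<mu> < 1)"

lemma mult_mat_vec_tendsto_0:
  fixes M :: "complex mat"
  assumes M: "M \<in> carrier_mat m n" and s: "\<And>k. s k \<in> carrier_vec n"
    and lim: "\<And>i. i < n \<Longrightarrow> (\<lambda>k. s k $ i) \<longlonglongrightarrow> 0" and i: "i < m"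
  shows "(\<lambda>k. (M *\<^sub>v s k) $ i) \<longlonglongrightarrow> 0"
proof -
  have "(\<lambda>k. \<Sum>j = 0..<n. M $$ (i, j) * s k $ j) \<longlonglongrightarrow> (\<Sum>j = 0..<n. M $$ (i, j) * 0)"
    by (intro tendsto_intros lim) auto
  moreover have "(M *\<^sub>v s k) $ i = (\<Sum>j = 0..<n. M $$ (i, j) * s k $ j)" for k
    using M i s[of k] by (simp add: scalar_prod_def)
  ultimately show ?thesis by simp
qed

text \<open>In the coordinates \<open>Q *\<^sub>v s k\<close> the system is upper triangular with
  the eigenvalues of \<open>M\<close> on the diagonal, and the transformed input still vanishes in
  the limit.\<close>

lemma schur_stable_recurrence_tendsto_0:
  assumes M: "M \<in> carrier_mat n n" "schur_stable M"
    and s: "\<And>k. s k \<in> carrier_vec n" and d: "\<And>k. d k \<in> carrier_vec n"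
    and step: "\<And>k. s (Suc k) = M *\<^sub>v s k + d k"
    and d_lim: "\<And>i. i < n \<Longrightarrow> (\<lambda>k. d k $ i) \<longlonglongrightarrow> 0"
    and i: "i < n"
  shows "(\<lambda>k. s k $ i) \<longlonglongrightarrow> 0"
proof -
  obtain D P Q where D: "D \<in> carrier_mat n n" and P: "P \<in> carrier_mat n n" and Q: "Q \<in> carrier_mat n n"
    and PQ: "P * Q = 1\<^sub>m n" and QP: "Q * P = 1\<^sub>m n" and MPDQ: "M = P * D * Q"
    and ut: "upper_triangular D" and ev: "\<And>i. i < n \<Longrightarrow> eigenvalue M (D $$ (i, i))"
    using complex_schur_triangularization[OF M(1)] by metis
  define t where "t k = Q *\<^sub>v s k" for k
  have t: "t k \<in> carrier_vec n" for k using Q s by (simp add: t_def)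
  have "Q * M = D * Q"
    unfolding MPDQ using D P Q QP
    by (simp add: mult_mat_left_cancel[of Q n n P _ n] assoc_mult_mat[of _ n n _ n _ n])
  then have "Q *\<^sub>v (M *\<^sub>v s k) = D *\<^sub>v t k" for k
    using assoc_mult_mat_vec[OF Q M(1) s] assoc_mult_mat_vec[OF D Q s] by (simp add: t_def)
  then have t_step: "t (Suc k) = D *\<^sub>v t k + Q *\<^sub>v d k" for k
    using M Q s[of k] d[of k] unfolding t_def step
    by (subst mult_add_distrib_mat_vec[of _ n n]) (auto simp: t_def)
  have t_lim: "(\<lambda>k. t k $ j) \<longlonglongrightarrow> 0" if "j < n" for j
  proof (rule upper_triangular_recurrence_tendsto_0[where B = D and d = "\<lambda>k. Q *\<^sub>v d k" and n = n])
    show "cmod (D $$ (i, i)) < 1" if "i < n" for i using ev[OF that] M(2) by (simp add: schur_stable_def)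
    show "Q *\<^sub>v d k \<in> carrier_vec n" for k using Q d by simp
    show "(\<lambda>k. (Q *\<^sub>v d k) $ i) \<longlonglongrightarrow> 0" if "i < n" for i
      by (rule mult_mat_vec_tendsto_0[OF Q d d_lim that])
  qed (use D ut t t_step that in auto)
  have "s k = P *\<^sub>v t k" for k
    using mult_mat_vec_left_cancel[OF P Q s PQ] by (simp add: t_def)
  then show ?thesis using mult_mat_vec_tendsto_0[OF P t t_lim i] by simp
qed

text \<open>Right multiplication by the triangularizing matrix \<open>P\<close> orders the columns
  of \<open>Y k = E k * P\<close> into a cascade: column \<open>j\<close> evolves under
  \<open>M + D $$ (j, j) \<cdot>\<^sub>m B\<close> and is driven only by the columns to its left. As
  \<open>D\<close> acts from the right, the induction runs upwards in \<open>j\<close>.\<close>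

lemma sylvester_recurrence_tendsto_0:
  fixes E :: "nat \<Rightarrow> complex mat"
  assumes M: "M \<in> carrier_mat n n" and B: "B \<in> carrier_mat n n" and N: "N \<in> carrier_mat p p"
    and stable: "\<And>\<nu>. eigenvalue N \<nu> \<Longrightarrow> schur_stable (M + \<nu> \<cdot>\<^sub>m B)"
    and E: "\<And>k. E k \<in> carrier_mat n p"
    and step: "\<And>k. E (Suc k) = M * E k + B * E k * N"
    and a: "a < n" and i: "i < p"
  shows "(\<lambda>k. E k $$ (a, i)) \<longlonglongrightarrow> 0"
proof -
  obtain D P Q where D: "D \<in> carrier_mat p p" and P: "P \<in> carrier_mat p p" and Q: "Q \<in> carrier_mat p p"
    and PQ: "P * Q = 1\<^sub>m p" and QP: "Q * P = 1\<^sub>m p" and NPDQ: "N = P * D * Q"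
    and ut: "upper_triangular D" and ev: "\<And>i. i < p \<Longrightarrow> eigenvalue N (D $$ (i, i))"
    using complex_schur_triangularization[OF N] by metis
  define Y where "Y k = E k * P" for k
  have Y: "Y k \<in> carrier_mat n p" for k using mult_carrier_mat[OF E P] by (simp add: Y_def)
  have "N * P = P * D"
    unfolding NPDQ using D P Q QP by (simp add: assoc_mult_mat[of _ p p _ p _ p])
  then have Y_step: "Y (Suc k) = M * Y k + B * (Y k * D)" for k
    using M N P D B E[of k]
    by (simp add: Y_def step add_mult_distrib_mat[of _ n p] assoc_mult_mat[of _ n n _ p _ p]
        assoc_mult_mat[of _ n p _ p _ p])
  have "\<forall>a<n. (\<lambda>k. Y k $$ (a, j)) \<longlonglongrightarrow> 0" if "j < p" for j
    using that
  proof (induction j rule: less_induct)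
    case (less j)
    \<comment> \<open>The strictly upper part of column \<open>j\<close> of \<open>D\<close>
      produces this input; it involves only columns that vanish in the limit by the induction
      hypothesis.\<close>
    define w where "w k = vec n (\<lambda>a. \<Sum>l<j. Y k $$ (a, l) * D $$ (l, j))" for k
    have w: "w k \<in> carrier_vec n" for k by (simp add: w_def)
    have w_lim: "(\<lambda>k. w k $ a) \<longlonglongrightarrow> 0" if "a < n" for a
    proof -
      have "(\<lambda>k. \<Sum>l<j. Y k $$ (a, l) * D $$ (l, j)) \<longlonglongrightarrow> (\<Sum>l<j. 0 * D $$ (l, j))"
        using less that by (intro tendsto_intros) auto
      then show ?thesis using that by (simp add: w_def)
    qed
    have YD: "col (Y k * D) j = D $$ (j, j) \<cdot>\<^sub>v col (Y k) j + w k" for k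
    proof (rule eq_vecI)
      fix a assume "a < dim_vec (D $$ (j, j) \<cdot>\<^sub>v col (Y k) j + w k)"
      then have a: "a < n" by (simp add: w_def)
      have "col (Y k * D) j $ a = (\<Sum>l = 0..<p. Y k $$ (a, l) * D $$ (l, j))"
        using a less.prems Y[of k] D by (simp add: scalar_prod_def)
      also have "\<dots> = (\<Sum>l\<in>{..<Suc j}. Y k $$ (a, l) * D $$ (l, j))"
        by (rule sum.mono_neutral_right) (use D less.prems ut in \<open>auto simp: upper_triangular_def\<close>)
      finally show "col (Y k * D) j $ a = (D $$ (j, j) \<cdot>\<^sub>v col (Y k) j + w k) $ a"
        using a less.prems Y[of k] by (simp add: w_def)
    qed (use Y[of k] in \<open>simp add: w_def\<close>)
    have col_step: "col (Y (Suc k)) j = (M + D $$ (j, j) \<cdot>\<^sub>m B) *\<^sub>v col (Y k) j + B *\<^sub>v w k" for k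
    proof -
      have c: "col (Y k) j \<in> carrier_vec n" using Y[of k] by auto
      have "col (Y (Suc k)) j = M *\<^sub>v col (Y k) j + B *\<^sub>v col (Y k * D) j"
        unfolding Y_step using Y[of k] D M B less.prems
        by (subst col_add[of _ n p]) (auto simp: col_mult2[of _ n n _ p])
      also have "\<dots> = M *\<^sub>v col (Y k) j + (D $$ (j, j) \<cdot>\<^sub>v (B *\<^sub>v col (Y k) j) + B *\<^sub>v w k)"
        unfolding YD using B c w[of k]
        by (subst mult_add_distrib_mat_vec[of _ n n]) (auto simp: mult_mat_vec[of _ n n])
      also have "\<dots> = (M + D $$ (j, j) \<cdot>\<^sub>m B) *\<^sub>v col (Y k) j + B *\<^sub>v w k"
        using B M c w[of k] by (auto simp: add_mult_distrib_mat_vec[of _ n n] smult_mat_mult_vec[of _ n n])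
      finally show ?thesis .
    qed
    have "(\<lambda>k. col (Y k) j $ a) \<longlonglongrightarrow> 0" if "a < n" for a
    proof (rule schur_stable_recurrence_tendsto_0[where s = "\<lambda>k. col (Y k) j" and n = n])
      show "col (Y k) j \<in> carrier_vec n" for k using Y[of k] by auto
      show "(\<lambda>k. (B *\<^sub>v w k) $ a) \<longlonglongrightarrow> 0" if "a < n" for a
        by (rule mult_mat_vec_tendsto_0[OF B w w_lim that])
    qed (use M B Y w that col_step stable[OF ev[OF less.prems]] in auto)
    moreover have "col (Y k) j $ a = Y k $$ (a, j)" if "a < n" for a k
      using that less.prems Y[of k] by simp
    ultimately show ?case by simp
  qed
  then have "(\<lambda>k. \<Sum>l = 0..<p. Y k $$ (a, l) * Q $$ (l, i)) \<longlonglongrightarrow> (\<Sum>l = 0..<p. 0 * Q $$ (l, i))"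
    using a by (intro tendsto_intros) auto
  moreover have "E k $$ (a, i) = (\<Sum>l = 0..<p. Y k $$ (a, l) * Q $$ (l, i))" for k
  proof -
    have "E k = Y k * Q" using E[of k] P Q PQ by (simp add: Y_def assoc_mult_mat[of _ n p _ p _ p])
    then show ?thesis using a i Y[of k] Q by (simp add: scalar_prod_def)
  qed
  ultimately show ?thesis by simp
qed

section \<open>Spectrum of a deflated connected matrix\<close>

text \<open>Equality case of a convex combination. After multiplication by the conjugate
  \<open>c\<close> of \<open>\<nu> * w i\<close>, the weighted mean of the real parts of
  \<open>c * w l\<close> is the square of \<open>cmod c\<close>, while maximality and the bound on
  \<open>\<nu>\<close> keep every term at most that large. Hence equality holds wherever the weight
  is positive.\<close>

lemma connected_matrix_max_modulus_arc:
  fixes w :: "nat \<Rightarrow> complex"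
  assumes conn: "connected_matrix p \<Lambda>"
    and w: "\<And>i. i < p \<Longrightarrow> (\<Sum>j<p. \<Lambda> $$ (i, j) * w j) = \<nu> * w i"
    and \<nu>: "1 \<le> cmod \<nu>" and i: "i < p" and max: "\<And>j. j < p \<Longrightarrow> cmod (w j) \<le> cmod (w i)"
    and arc: "(i, j) \<in> graph_arcs p \<Lambda>"
  shows "w j = w i"
proof (cases "w i = 0")
  case True
  then show ?thesis using max[of j] arc by (simp add: graph_arcs_def)
next
  case False
  define c where "c = cnj (\<nu> * w i)"
  have c0: "c \<noteq> 0" using False \<nu> by (auto simp: c_def)
  have le_c: "cmod (w i) \<le> cmod c"
    using mult_right_mono[OF \<nu>, of "cmod (w i)"] by (simp add: c_def norm_mult)
  have norm_le: "cmod (c * w l) \<le> (cmod c)\<^sup>2" if "l < p" for l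
    using max[OF that] le_c mult_left_mono[of "cmod (w l)" "cmod c" "cmod c"]
    by (simp add: norm_mult power2_eq_square)
  then have le: "Re (c * w l) \<le> (cmod c)\<^sup>2" if "l < p" for l
    using that complex_Re_le_cmod[of "c * w l"] by force
  have rows: "(\<Sum>l<p. \<Lambda> $$ (i, l)) = 1" and nonneg: "\<And>l. l < p \<Longrightarrow> 0 \<le> \<Lambda> $$ (i, l)"
    and diag: "0 < \<Lambda> $$ (i, i)" using conn i by (auto simp: connected_matrix_def)
  have "(\<Sum>l<p. \<Lambda> $$ (i, l) * Re (c * w l)) = Re (c * (\<Sum>l<p. \<Lambda> $$ (i, l) * w l))"
    by (simp add: sum_distrib_left algebra_simps)
  also have "\<dots> = (cmod c)\<^sup>2"
    using complex_norm_square[of c, symmetric] unfolding w[OF i] by (simp add: c_def)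
  finally have "(\<Sum>l<p. \<Lambda> $$ (i, l) * ((cmod c)\<^sup>2 - Re (c * w l))) = 0"
    using rows by (simp add: right_diff_distrib sum_subtractf flip: sum_distrib_right)
  then have zero: "\<Lambda> $$ (i, l) * ((cmod c)\<^sup>2 - Re (c * w l)) = 0" if "l < p" for l
    using that le nonneg by (subst (asm) sum_nonneg_eq_0_iff) auto
  have eq: "c * w l = (cmod c)\<^sup>2" if "l < p" "0 < \<Lambda> $$ (i, l)" for l
  proof -
    have re: "Re (c * w l) = (cmod c)\<^sup>2" using zero[OF that(1)] that(2) by simp
    \<comment> \<open>The real part already exhausts the bound \<open>norm_le\<close> on the
      modulus, which leaves nothing for the imaginary part.\<close>
    then have "(Im (c * w l))\<^sup>2 \<le> 0"
      using power_mono[OF norm_le[OF that(1)], of 2] cmod_power2[of "c * w l"] by simp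
    then have "Im (c * w l) = 0" by simp
    with re show ?thesis by (simp add: complex_eq_iff)
  qed
  \<comment> \<open>The positive diagonal entry makes \<open>i\<close> itself one of the indices of
    positive weight, so \<open>w i\<close> and \<open>w j\<close> are compared through the same
    value.\<close>
  have "c * w j = c * w i" using eq[of j] eq[OF i diag] arc by (simp add: graph_arcs_def)
  with c0 show ?thesis by simp
qed

text \<open>Equality of values passes maximality on to the next node, so the argument for a single
  arc can be repeated along the path.\<close>

lemma connected_matrix_max_modulus_path:
  fixes w :: "nat \<Rightarrow> complex"
  assumes conn: "connected_matrix p \<Lambda>"
    and w: "\<And>i. i < p \<Longrightarrow> (\<Sum>j<p. \<Lambda> $$ (i, j) * w j) = \<nu> * w i"
    and \<nu>: "1 \<le> cmod \<nu>" and i: "i < p" and max: "\<And>j. j < p \<Longrightarrow> cmod (w j) \<le> cmod (w i)"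
    and path: "(i, j) \<in> (graph_arcs p \<Lambda>)\<^sup>*"
  shows "w j = w i"
  using path
proof induction
  case (step j l)
  have "j < p" using step.hyps(2) by (simp add: graph_arcs_def)
  then show ?case
    using connected_matrix_max_modulus_arc[OF conn w \<nu> _ _ step.hyps(2)] max step.IH by simp
qed simp

text \<open>Unless \<open>w\<close> vanishes, the row of an index of maximal modulus forces
  \<open>\<nu> = 1\<close>. Then \<open>w\<close> minus its value at a node \<open>q\<close>
  reachable from all others is again a solution, and the maximum modulus argument carries its value
  0 at \<open>q\<close> back to the index where its modulus is largest.\<close>

lemma connected_matrix_peripheral_eigenvector_constant:
  fixes w :: "nat \<Rightarrow> complex"
  assumes conn: "connected_matrix p \<Lambda>"
    and w: "\<And>i. i < p \<Longrightarrow> (\<Sum>j<p. \<Lambda> $$ (i, j) * w j) = \<nu> * w i"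
    and \<nu>: "1 \<le> cmod \<nu>"
  obtains c where "\<And>i. i < p \<Longrightarrow> w i = c"
proof -
  obtain q where q: "q < p" "\<And>i. i < p \<Longrightarrow> (i, q) \<in> (graph_arcs p \<Lambda>)\<^sup>*"
    using conn by (auto simp: connected_matrix_def)
  have max_ex: "\<exists>i<p. \<forall>j<p. cmod (f j) \<le> cmod (f i)" for f :: "nat \<Rightarrow> complex"
  proof -
    have "Max ((\<lambda>j. cmod (f j)) ` {..<p}) \<in> (\<lambda>j. cmod (f j)) ` {..<p}"
      using q(1) by (intro Max_in) auto
    then obtain i where "i < p" "Max ((\<lambda>j. cmod (f j)) ` {..<p}) = cmod (f i)" by auto
    then show ?thesis by (metis Max_ge finite_imageI finite_lessThan imageI lessThan_iff)
  qed
  have rows: "(\<Sum>l<p. complex_of_real (\<Lambda> $$ (i, l))) = 1" if "i < p" for i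
    using conn that unfolding connected_matrix_def by (metis of_real_1 of_real_sum)
  have const_if_1: "w i = w q" if eq1: "\<And>i. i < p \<Longrightarrow> (\<Sum>j<p. \<Lambda> $$ (i, j) * w j) = w i" and "i < p" for i
  proof -
    \<comment> \<open>Constants solve the equation for eigenvalue 1 because rows sum to 1. Thus
      \<open>f\<close> is a solution as well, now with \<open>f q = 0\<close>.\<close>
    define f where "f j = w j - w q" for j
    have f: "(\<Sum>j<p. \<Lambda> $$ (i, j) * f j) = 1 * f i" if "i < p" for i
      using eq1[OF that] rows[OF that]
      by (simp add: f_def right_diff_distrib sum_subtractf flip: sum_distrib_right)
    obtain i0 where i0: "i0 < p" "\<And>j. j < p \<Longrightarrow> cmod (f j) \<le> cmod (f i0)" using max_ex by blast
    have "f i0 = f q"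
      using connected_matrix_max_modulus_path[OF conn f _ i0 q(2)[OF i0(1)]] by simp
    then show ?thesis using i0(2)[OF \<open>i < p\<close>] by (simp add: f_def)
  qed
  obtain i0 where i0: "i0 < p" "\<And>j. j < p \<Longrightarrow> cmod (w j) \<le> cmod (w i0)" using max_ex by blast
  show thesis
  proof (cases "w i0 = 0")
    case True
    then have "w i = 0" if "i < p" for i using i0(2)[OF that] by simp
    with that show thesis by blast
  next
    case False
    \<comment> \<open>At the maximal index \<open>i0\<close> all entries of positive weight equal
      \<open>w i0\<close>, so the row reduces to its sum 1 times \<open>w i0\<close>.\<close>
    have "\<nu> * w i0 = (\<Sum>j<p. \<Lambda> $$ (i0, j) * w i0)"
      unfolding w[OF i0(1), symmetric]
    proof (rule sum.cong)
      fix j assume "j \<in> {..<p}"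
      then show "\<Lambda> $$ (i0, j) * w j = \<Lambda> $$ (i0, j) * w i0"
        using connected_matrix_max_modulus_arc[OF conn w \<nu> i0, of j] conn i0(1)
        by (cases "\<Lambda> $$ (i0, j) = 0") (auto simp: graph_arcs_def connected_matrix_def less_le)
    qed simp
    also have "\<dots> = w i0" using rows[OF i0(1)] by (simp flip: sum_distrib_right)
    finally have "\<nu> = 1" using False by simp
    then show thesis using const_if_1 w that by simp
  qed
qed

text \<open>The row vector \<open>r\<close> annihilates the deflated matrix. Pairing it with an
  eigenvector \<open>v\<close> for \<open>\<nu>\<close> outside the open disc gives
  \<open>\<sigma> = 0\<close>, so \<open>v\<close> is an eigenvector of \<open>\<Lambda>\<close>
  itself and hence constant; as the entries of \<open>r\<close> sum to 1, that constant equals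
  \<open>\<sigma>\<close>, which is zero.\<close>

lemma connected_matrix_deflated_eigenvalue:
  assumes \<Lambda>: "\<Lambda> \<in> carrier_mat p p" and conn: "connected_matrix p \<Lambda>"
    and r_left: "\<And>j. j < p \<Longrightarrow> (\<Sum>i<p. r $ i * \<Lambda> $$ (i, j)) = r $ j"
    and r_sum: "(\<Sum>i<p. r $ i) = 1"
    and ev: "eigenvalue (cmat (\<Lambda> - mat p p (\<lambda>(i, j). r $ j))) \<nu>"
  shows "cmod \<nu> < 1"
proof (rule ccontr)
  assume "\<not> cmod \<nu> < 1"
  then have \<nu>: "1 \<le> cmod \<nu>" by simp
  from ev obtain v where v: "v \<in> carrier_vec p" "v \<noteq> 0\<^sub>v p"
    and eq: "cmat (\<Lambda> - mat p p (\<lambda>(i, j). r $ j)) *\<^sub>v v = \<nu> \<cdot>\<^sub>v v"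
    unfolding eigenvalue_def eigenvector_def using \<Lambda> by auto
  define \<sigma> where "\<sigma> = (\<Sum>j<p. r $ j * v $ j)"
  have row: "(\<Sum>j<p. \<Lambda> $$ (i, j) * v $ j) - \<sigma> = \<nu> * v $ i" if i: "i < p" for i
  proof -
    have "\<nu> * v $ i = (cmat (\<Lambda> - mat p p (\<lambda>(i, j). r $ j)) *\<^sub>v v) $ i" using v i by (simp add: eq)
    also have "\<dots> = (\<Sum>j = 0..<p. (\<Lambda> $$ (i, j) - r $ j) * v $ j)"
      using v i \<Lambda> by (simp add: scalar_prod_def)
    also have "\<dots> = (\<Sum>j<p. \<Lambda> $$ (i, j) * v $ j) - \<sigma>"
      by (simp add: \<sigma>_def left_diff_distrib sum_subtractf lessThan_atLeast0)
    finally show ?thesis by simp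
  qed
  have row': "(\<Sum>i<p. r $ i * ((\<Sum>j<p. \<Lambda> $$ (i, j) * v $ j) - \<sigma>)) = (\<Sum>i<p. r $ i * (\<nu> * v $ i))"
    by (simp add: row)
  have "\<nu> * \<sigma> = (\<Sum>i<p. r $ i * ((\<Sum>j<p. \<Lambda> $$ (i, j) * v $ j) - \<sigma>))"
    unfolding row' by (simp add: \<sigma>_def sum_distrib_left ac_simps)
  also have "\<dots> = (\<Sum>i<p. \<Sum>j<p. r $ i * \<Lambda> $$ (i, j) * v $ j) - (\<Sum>i<p. r $ i) * \<sigma>"
    by (simp add: right_diff_distrib sum_subtractf sum_distrib_left sum_distrib_right mult.assoc)
  also have "(\<Sum>i<p. \<Sum>j<p. r $ i * \<Lambda> $$ (i, j) * v $ j)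
      = (\<Sum>j<p. complex_of_real (\<Sum>i<p. r $ i * \<Lambda> $$ (i, j)) * v $ j)"
    by (subst sum.swap) (simp add: sum_distrib_right)
  also have "\<dots> = \<sigma>" by (simp add: r_left \<sigma>_def)
  finally have "\<nu> * \<sigma> = 0" using r_sum by simp
  then have \<sigma>: "\<sigma> = 0" using \<nu> by auto
  obtain c where c: "\<And>i. i < p \<Longrightarrow> v $ i = c"
    using connected_matrix_peripheral_eigenvector_constant[OF conn _ \<nu>, of "\<lambda>j. v $ j"] row \<sigma> by auto
  have "\<sigma> = complex_of_real (\<Sum>i<p. r $ i) * c" by (simp add: \<sigma>_def c sum_distrib_right)
  then have "c = 0" using \<sigma> r_sum by simp
  then have "v = 0\<^sub>v p" using v(1) c by (intro eq_vecI) auto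
  with v(2) show False by simp
qed

section \<open>Stability of the error modes\<close>

lemma cmat_zero [simp]: "cmat (0\<^sub>m a b) = 0\<^sub>m a b"
  by (intro eq_matI) auto

lemma zero_mult_vec:
  fixes v :: "'a :: comm_ring_1 vec"
  assumes "v \<in> carrier_vec m"
  shows "0\<^sub>m n m *\<^sub>v v = 0\<^sub>v n"
  using assms by (intro eq_vecI) auto

lemma mult_vec_zero:
  fixes A :: "'a :: comm_ring_1 mat"
  assumes "A \<in> carrier_mat n m"
  shows "A *\<^sub>v 0\<^sub>v m = 0\<^sub>v n"
  using assms by (intro eq_vecI) auto

lemma smult_vec_zero [simp]: "c \<cdot>\<^sub>v 0\<^sub>v n = (0\<^sub>v n :: 'a :: comm_ring_1 vec)"
  by (intro eq_vecI) auto

lemma cmat_mult: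
  assumes "A \<in> carrier_mat n m" "B \<in> carrier_mat m q"
  shows "cmat (A * B) = cmat A * cmat B"
  using of_real_hom.mat_hom_mult[OF assms] .

lemma cmat_mult_vec:
  assumes "A \<in> carrier_mat n m" "B \<in> carrier_mat m q" "v \<in> carrier_vec q"
  shows "cmat (A * B) *\<^sub>v v = cmat A *\<^sub>v (cmat B *\<^sub>v v)"
  using assms by (simp add: cmat_mult[OF assms(1,2)])

lemma cmat_pow:
  assumes "A \<in> carrier_mat n n"
  shows "cmat (A ^\<^sub>m k) = cmat A ^\<^sub>m k"
  using of_real_hom.mat_hom_pow[OF assms] .

lemma Re_cmat_mult_vec:
  assumes "A \<in> carrier_mat n m" "v \<in> carrier_vec m"
  shows "map_vec Re (cmat A *\<^sub>v v) = A *\<^sub>v map_vec Re v"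
  using assms by (intro eq_vecI) (auto simp: scalar_prod_def)

lemma Im_cmat_mult_vec:
  assumes "A \<in> carrier_mat n m" "v \<in> carrier_vec m"
  shows "map_vec Im (cmat A *\<^sub>v v) = A *\<^sub>v map_vec Im v"
  using assms by (intro eq_vecI) (auto simp: scalar_prod_def)

lemma abs_index_le_norm2:
  assumes "w \<in> carrier_vec n" "i < n"
  shows "\<bar>w $ i\<bar> \<le> norm2 w"
proof -
  have "(w $ i)\<^sup>2 \<le> w \<bullet> w"
    using assms member_le_sum[of i "{0..<n}" "\<lambda>i. w $ i * w $ i"]
    by (simp add: scalar_prod_def power2_eq_square)
  then show ?thesis unfolding norm2_def by (metis real_sqrt_abs real_sqrt_le_iff)
qed

lemma eigenvector_pow_mult_vec:
  fixes A :: "'a :: field mat"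
  assumes A: "A \<in> carrier_mat n n" and v: "v \<in> carrier_vec n" and eq: "A *\<^sub>v v = \<mu> \<cdot>\<^sub>v v"
  shows "A ^\<^sub>m k *\<^sub>v v = \<mu> ^ k \<cdot>\<^sub>v v"
proof (induction k)
  case (Suc k)
  have "A ^\<^sub>m Suc k *\<^sub>v v = A ^\<^sub>m k *\<^sub>v (\<mu> \<cdot>\<^sub>v v)"
    using A v by (simp add: assoc_mult_mat_vec[of _ n n _ n] flip: eq)
  also have "\<dots> = \<mu> \<cdot>\<^sub>v (\<mu> ^ k \<cdot>\<^sub>v v)"
    using A v by (simp add: mult_mat_vec[of _ n n] flip: Suc)
  finally show ?case by (simp add: smult_smult_assoc)
qed (use A v in auto)

text \<open>One direction of the Hautus test. The real and imaginary parts of \<open>v\<close> are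
  unobservable states, so detectability sends their trajectories to zero. But together these make up
  the powers of \<open>\<mu>\<close> times \<open>v\<close>, whose entries never become smaller in
  modulus than those of \<open>v\<close>.\<close>

lemma detectable_eigenvector_in_kernel:
  assumes A: "A \<in> carrier_mat n n" and C: "C \<in> carrier_mat m n" and detect: "detectable n m C A"
    and v: "v \<in> carrier_vec n" and eq: "cmat A *\<^sub>v v = \<mu> \<cdot>\<^sub>v v" and \<mu>: "1 \<le> cmod \<mu>"
    and ker: "cmat C *\<^sub>v v = 0\<^sub>v m"
  shows "v = 0\<^sub>v n"
proof -
  have pow: "cmat (A ^\<^sub>m k) *\<^sub>v v = \<mu> ^ k \<cdot>\<^sub>v v" for k
    using A v eigenvector_pow_mult_vec[OF _ v eq] by (simp add: cmat_pow)
  have map_0: "map_vec Re (0\<^sub>v m) = 0\<^sub>v m" "map_vec Im (0\<^sub>v m) = 0\<^sub>v m" by auto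
  have unobs: "cmat (C * A ^\<^sub>m k) *\<^sub>v v = 0\<^sub>v m" for k
    using A C v ker by (simp add: cmat_mult_vec[of _ m n _ n] pow mult_mat_vec[of _ m n])
  have re: "(C * A ^\<^sub>m k) *\<^sub>v map_vec Re v = 0\<^sub>v m" for k
    using A C v Re_cmat_mult_vec[of "C * A ^\<^sub>m k" m n v] by (simp add: unobs map_0)
  have im: "(C * A ^\<^sub>m k) *\<^sub>v map_vec Im v = 0\<^sub>v m" for k
    using A C v Im_cmat_mult_vec[of "C * A ^\<^sub>m k" m n v] by (simp add: unobs map_0)
  have lim: "(\<lambda>k. norm2 (A ^\<^sub>m k *\<^sub>v map_vec Re v)) \<longlonglongrightarrow> 0" "(\<lambda>k. norm2 (A ^\<^sub>m k *\<^sub>v map_vec Im v)) \<longlonglongrightarrow> 0"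
    using detect v re im unfolding detectable_def by auto
  have "v $ i = 0" if i: "i < n" for i
  proof -
    have re_le: "\<bar>Re (\<mu> ^ k * v $ i)\<bar> \<le> norm2 (A ^\<^sub>m k *\<^sub>v map_vec Re v)"
      and im_le: "\<bar>Im (\<mu> ^ k * v $ i)\<bar> \<le> norm2 (A ^\<^sub>m k *\<^sub>v map_vec Im v)" for k
      using abs_index_le_norm2[OF _ i, of "A ^\<^sub>m k *\<^sub>v map_vec Re v"]
        abs_index_le_norm2[OF _ i, of "A ^\<^sub>m k *\<^sub>v map_vec Im v"] A v i
        Re_cmat_mult_vec[of "A ^\<^sub>m k" n n v, symmetric] Im_cmat_mult_vec[of "A ^\<^sub>m k" n n v, symmetric]
      by (auto simp: pow)
    have bound: "cmod (v $ i)
        \<le> norm2 (A ^\<^sub>m k *\<^sub>v map_vec Re v) + norm2 (A ^\<^sub>m k *\<^sub>v map_vec Im v)" for k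
    proof -
      have "cmod (v $ i) \<le> cmod (\<mu> ^ k * v $ i)"
        using mult_right_mono[OF one_le_power[OF \<mu>, of k], of "cmod (v $ i)"]
        by (simp add: norm_mult norm_power)
      also have "\<dots> \<le> \<bar>Re (\<mu> ^ k * v $ i)\<bar> + \<bar>Im (\<mu> ^ k * v $ i)\<bar>" by (rule cmod_le)
      finally show ?thesis using re_le[of k] im_le[of k] by linarith
    qed
    have "cmod (v $ i) \<le> 0"
      using tendsto_lowerbound[OF tendsto_add[OF lim], of "cmod (v $ i)"] bound by simp
    then show ?thesis by simp
  qed
  with v show ?thesis by (intro eq_vecI) auto
qed

section \<open>Hermitian inner products and the contracted rotation\<close>

lemma cmat_adjoint:
  assumes A: "A \<in> carrier_mat n m" and v: "v \<in> carrier_vec m" and w: "w \<in> carrier_vec n"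
  shows "(cmat A *\<^sub>v v) \<bullet>c w = v \<bullet>c (cmat (A\<^sup>T) *\<^sub>v w)"
proof -
  have "(cmat A *\<^sub>v v) \<bullet>c w = (\<Sum>i = 0..<n. \<Sum>j = 0..<m. A $$ (i, j) * v $ j * cnj (w $ i))"
    using A v w by (simp add: scalar_prod_def sum_distrib_right)
  also have "\<dots> = v \<bullet>c (cmat (A\<^sup>T) *\<^sub>v w)"
    using A v w by (subst sum.swap) (simp add: scalar_prod_def sum_distrib_left mult_ac)
  finally show ?thesis .
qed

lemma isometry_inner_prod:
  assumes A: "A \<in> carrier_mat n m" and iso: "A\<^sup>T * A = 1\<^sub>m m" and v: "v \<in> carrier_vec m"
  shows "(cmat A *\<^sub>v v) \<bullet>c (cmat A *\<^sub>v v) = v \<bullet>c v"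
  using A v cmat_mult_vec[of "A\<^sup>T" m n A m v]
  by (simp add: cmat_adjoint[of A n m] iso of_real_hom.mat_hom_one)

lemma smult_inner_prod_self:
  fixes v :: "complex vec"
  shows "(c \<cdot>\<^sub>v v) \<bullet>c (c \<cdot>\<^sub>v v) = (cmod c)\<^sup>2 * (v \<bullet>c v)"
  by (simp add: scalar_prod_def sum_distrib_left complex_norm_square mult_ac del: of_real_power)

text \<open>Pythagoras: the kernel of \<open>H\<close> is orthogonal to the range of
  \<open>H\<^sup>T\<close>, and \<open>H * H\<^sup>T = 1\<^sub>m m\<close> makes
  \<open>H\<^sup>T\<close> an isometry.\<close>

lemma orthogonal_add_inner_prod:
  fixes a :: "complex vec"
  assumes H: "H \<in> carrier_mat m n" "H * H\<^sup>T = 1\<^sub>m m"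
    and a: "a \<in> carrier_vec n" "cmat H *\<^sub>v a = 0\<^sub>v m" and h: "h \<in> carrier_vec m"
  shows "(a + cmat (H\<^sup>T) *\<^sub>v h) \<bullet>c (a + cmat (H\<^sup>T) *\<^sub>v h) = a \<bullet>c a + h \<bullet>c h"
proof -
  define g where "g = cmat (H\<^sup>T) *\<^sub>v h"
  have g: "g \<in> carrier_vec n" using H h by (simp add: g_def)
  have ga: "g \<bullet>c a = 0"
    using cmat_adjoint[of "H\<^sup>T" n m h a] H a h by (simp add: g_def)
  then have ag: "a \<bullet>c g = 0"
    by (metis a(1) g conjugate_vec_sprod_comm conjugate_conjugate_sprod conjugate_zero)
  have gg: "g \<bullet>c g = h \<bullet>c h"
    unfolding g_def using isometry_inner_prod[of "H\<^sup>T" n m h] H h by simp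
  have "(a + g) \<bullet>c (a + g) = a \<bullet>c a + a \<bullet>c g + (g \<bullet>c a + g \<bullet>c g)"
    using a(1) g by (simp add: conjugate_add_vec[of _ n] add_scalar_prod_distrib[of _ n]
        scalar_prod_add_distrib[of _ n])
  then show ?thesis by (simp add: ga ag gg flip: g_def)
qed

text \<open>Replacing the \<open>H\<^sup>T\<close>-component of \<open>\<omega>\<close> by its multiple by \<open>\<nu>\<close> loses \<open>(1 - |\<nu>|\<^sup>2) |H \<omega>|\<^sup>2\<close>
  of squared length.\<close>

lemma contracted_rotation_eigenvector:
  assumes \<Phi>: "\<Phi> \<in> carrier_mat n n" "\<Phi>\<^sup>T * \<Phi> = 1\<^sub>m n" and H: "H \<in> carrier_mat m n" "H * H\<^sup>T = 1\<^sub>m m"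
    and \<omega>: "\<omega> \<in> carrier_vec n" and \<nu>: "cmod \<nu> < 1" and \<mu>: "1 \<le> cmod \<mu>"
    and eq: "cmat \<Phi> *\<^sub>v (\<omega> + (\<nu> - 1) \<cdot>\<^sub>v (cmat (H\<^sup>T) *\<^sub>v (cmat H *\<^sub>v \<omega>))) = \<mu> \<cdot>\<^sub>v \<omega>"
  shows "cmat H *\<^sub>v \<omega> = 0\<^sub>v m"
proof -
  define h where "h = cmat H *\<^sub>v \<omega>"
  define g where "g = cmat (H\<^sup>T) *\<^sub>v h"
  define a where "a = \<omega> - g"
  have h: "h \<in> carrier_vec m" using H \<omega> by (simp add: h_def)
  have g: "g \<in> carrier_vec n" using H h by (simp add: g_def)
  have a: "a \<in> carrier_vec n" using \<omega> g by (simp add: a_def)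
  have "cmat H *\<^sub>v g = h"
    using cmat_mult_vec[of H m n "H\<^sup>T" m h] H h by (simp add: g_def of_real_hom.mat_hom_one)
  then have Ha: "cmat H *\<^sub>v a = 0\<^sub>v m"
    using H \<omega> g h by (simp add: a_def mult_minus_distrib_mat_vec[of _ m n] h_def[symmetric])
  have ga: "cmat (H\<^sup>T) *\<^sub>v (c \<cdot>\<^sub>v h) = c \<cdot>\<^sub>v g" for c
    using H h by (simp add: g_def mult_mat_vec[of _ n m])
  \<comment> \<open>Both vectors have the same component \<open>a\<close> in the kernel of
    \<open>H\<close>; they differ only in whether \<open>h\<close> or
    \<open>\<nu> \<cdot>\<^sub>v h\<close> is lifted by \<open>H\<^sup>T\<close>.\<close>
  have split1: "\<omega> = a + cmat (H\<^sup>T) *\<^sub>v h"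
    using \<omega> g by (auto simp: a_def g_def[symmetric])
  have split2: "\<omega> + (\<nu> - 1) \<cdot>\<^sub>v g = a + cmat (H\<^sup>T) *\<^sub>v (\<nu> \<cdot>\<^sub>v h)"
    unfolding ga using \<omega> g by (intro eq_vecI) (auto simp: a_def algebra_simps)
  have "(cmod \<mu>)\<^sup>2 * (\<omega> \<bullet>c \<omega>) = (\<omega> + (\<nu> - 1) \<cdot>\<^sub>v g) \<bullet>c (\<omega> + (\<nu> - 1) \<cdot>\<^sub>v g)"
    using isometry_inner_prod[OF \<Phi>, of "\<omega> + (\<nu> - 1) \<cdot>\<^sub>v g"] eq \<omega> g
    by (simp add: g_def h_def smult_inner_prod_self)
  also have "\<dots> = a \<bullet>c a + (cmod \<nu>)\<^sup>2 * (h \<bullet>c h)"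
    unfolding split2 using h by (simp add: orthogonal_add_inner_prod[OF H a Ha] smult_inner_prod_self)
  finally have 1: "(cmod \<mu>)\<^sup>2 * (\<omega> \<bullet>c \<omega>) = a \<bullet>c a + (cmod \<nu>)\<^sup>2 * (h \<bullet>c h)" .
  have 2: "\<omega> \<bullet>c \<omega> = a \<bullet>c a + h \<bullet>c h"
    using orthogonal_add_inner_prod[OF H a Ha h] unfolding split1[symmetric] .
  have nonneg: "0 \<le> Re (\<omega> \<bullet>c \<omega>)" "0 \<le> Re (h \<bullet>c h)" and real: "Im (h \<bullet>c h) = 0"
    using conjugate_square_ge_0_vec[of \<omega>] conjugate_square_ge_0_vec[of h] by (auto simp: less_eq_complex_def)
  have "Re (\<omega> \<bullet>c \<omega>) \<le> (cmod \<mu>)\<^sup>2 * Re (\<omega> \<bullet>c \<omega>)"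
    using mult_right_mono[OF one_le_power[OF \<mu>, of 2] nonneg(1)] by simp
  \<comment> \<open>Since \<open>cmod \<mu>\<close> is at least 1, equation \<open>1\<close> bounds
    the squared length of \<open>\<omega>\<close> by that of the contracted vector. The common term
    from \<open>a\<close> cancels against \<open>2\<close>.\<close>
  then have "Re (h \<bullet>c h) \<le> (cmod \<nu>)\<^sup>2 * Re (h \<bullet>c h)"
    using arg_cong[OF 1, of Re] arg_cong[OF 2, of Re] by (simp flip: of_real_power)
  then have "(1 - (cmod \<nu>)\<^sup>2) * Re (h \<bullet>c h) \<le> 0" by (simp add: algebra_simps)
  moreover have "(cmod \<nu>)\<^sup>2 < 1" using \<nu> by (simp add: power_less_one_iff)
  ultimately have "Re (h \<bullet>c h) \<le> 0" by (simp add: mult_le_0_iff)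
  then have "Re (h \<bullet>c h) = 0" using nonneg(2) by simp
  then have "h \<bullet>c h = 0" using real by (simp add: complex_eq_iff)
  then show ?thesis using h conjugate_square_eq_0_vec[OF h] by (simp add: h_def)
qed

text \<open>Here \<open>X\<close> spans the invariant subspace of the unit eigenvalues,
  \<open>V\<close> gives the coordinates on it, and \<open>V2\<close> those on the complementary
  block \<open>G\<close>. If \<open>V2\<close> does not kill an eigenvector \<open>v\<close>, its
  image is an eigenvector of \<open>G\<close>. Otherwise \<open>v\<close> lies in the range of
  \<open>X\<close>, where the mode is a contracted rotation; for \<open>\<mu>\<close> outside the
  open disc this leads to an eigenvector of \<open>A\<close> in the kernel of
  \<open>C\<close>.\<close>

lemma coupled_mode_schur_stable_coordinates:
  assumes A: "A \<in> carrier_mat n n" and C: "C \<in> carrier_mat m n" and L: "L \<in> carrier_mat n m"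
    and detect: "detectable n m C A" and \<nu>: "cmod \<nu> < 1"
    and X: "X \<in> carrier_mat n n1" and V: "V \<in> carrier_mat n1 n"
    and W: "W \<in> carrier_mat n n2" and V2: "V2 \<in> carrier_mat n2 n"
    and \<Phi>: "\<Phi> \<in> carrier_mat n1 n1" and G: "G \<in> carrier_mat n2 n2"
    and H: "H \<in> carrier_mat m n1" and K: "K \<in> carrier_mat m m"
    and resolution: "X * V + W * V2 = 1\<^sub>m n" and VX: "V * X = 1\<^sub>m n1"
    and V2A: "V2 * A = G * V2" and V2L: "V2 * L = 0\<^sub>m n2 m"
    and AX: "A * X = X * \<Phi>" and LCX: "L * (C * X) = X * (\<Phi> * (H\<^sup>T * H))" and CX: "C * X = K * H"
    and \<Phi>_orth: "\<Phi>\<^sup>T * \<Phi> = 1\<^sub>m n1" and H_orth: "H * H\<^sup>T = 1\<^sub>m m"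
    and G_stable: "schur_stable (cmat G)"
  shows "schur_stable (cmat (A - L * C) + \<nu> \<cdot>\<^sub>m cmat (L * C))"
  unfolding schur_stable_def
proof (intro allI impI)
  fix \<mu>
  define M where "M = cmat (A - L * C) + \<nu> \<cdot>\<^sub>m cmat (L * C)"
  have M: "M \<in> carrier_mat n n" using A C L by (simp add: M_def)
  have M_mult: "M *\<^sub>v v = cmat A *\<^sub>v v + (\<nu> - 1) \<cdot>\<^sub>v (cmat L *\<^sub>v (cmat C *\<^sub>v v))"
    if "v \<in> carrier_vec n" for v
  proof -
    have LC: "L * C \<in> carrier_mat n n" using L C by simp
    have eqM: "M = cmat A + (\<nu> - 1) \<cdot>\<^sub>m cmat (L * C)"
      using A L C by (intro eq_matI) (auto simp: M_def algebra_simps)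
    show ?thesis
      unfolding eqM using that A LC
      by (simp add: add_mult_distrib_mat_vec[of _ n n] smult_mat_mult_vec[of _ n n]
          cmat_mult_vec[OF L C])
  qed
  assume "eigenvalue (cmat (A - L * C) + \<nu> \<cdot>\<^sub>m cmat (L * C)) \<mu>"
  then obtain v where v: "v \<in> carrier_vec n" "v \<noteq> 0\<^sub>v n" and Mv: "M *\<^sub>v v = \<mu> \<cdot>\<^sub>v v"
    unfolding eigenvalue_def eigenvector_def M_def[symmetric] using M by auto
  define \<zeta> where "\<zeta> = cmat V2 *\<^sub>v v"
  have \<zeta>: "\<zeta> \<in> carrier_vec n2" using V2 v by (simp add: \<zeta>_def)
  have CAv: "cmat A *\<^sub>v v \<in> carrier_vec n" "cmat L *\<^sub>v (cmat C *\<^sub>v v) \<in> carrier_vec n" "cmat C *\<^sub>v v \<in> carrier_vec m"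
    using A L C v by auto
  show "cmod \<mu> < 1"
  proof (cases "\<zeta> = 0\<^sub>v n2")
    case False
    \<comment> \<open>The feedback is invisible on the complementary block because
      \<open>V2 * L\<close> vanishes.\<close>
    have "cmat V2 *\<^sub>v (cmat L *\<^sub>v (cmat C *\<^sub>v v)) = 0\<^sub>v n2"
      using cmat_mult_vec[OF V2 L CAv(3)] CAv(3) by (simp add: V2L zero_mult_vec[of _ m])
    moreover have "cmat V2 *\<^sub>v (cmat A *\<^sub>v v) = cmat G *\<^sub>v \<zeta>"
      using cmat_mult_vec[OF V2 A v(1)] cmat_mult_vec[OF G V2 v(1)] by (simp add: V2A \<zeta>_def)
    ultimately have "cmat V2 *\<^sub>v (M *\<^sub>v v) = cmat G *\<^sub>v \<zeta>"
      unfolding M_mult[OF v(1)] using V2 G \<zeta> CAv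
      by (simp add: mult_add_distrib_mat_vec[of _ n2 n] mult_mat_vec[of _ n2 n])
    then have "cmat G *\<^sub>v \<zeta> = \<mu> \<cdot>\<^sub>v \<zeta>"
      unfolding Mv using V2 v by (simp add: \<zeta>_def mult_mat_vec[of _ n2 n])
    then have "eigenvalue (cmat G) \<mu>"
      unfolding eigenvalue_def eigenvector_def using G \<zeta> False by auto
    then show ?thesis using G_stable by (simp add: schur_stable_def)
  next
    case True
    show ?thesis
    proof (rule ccontr)
      assume "\<not> cmod \<mu> < 1"
      then have \<mu>: "1 \<le> cmod \<mu>" by simp
      define \<omega> where "\<omega> = cmat V *\<^sub>v v"
      have \<omega>: "\<omega> \<in> carrier_vec n1" using V v by (simp add: \<omega>_def)
      have "v = cmat (X * V + W * V2) *\<^sub>v v" using v by (simp add: resolution of_real_hom.mat_hom_one)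
      also have "cmat (X * V + W * V2) = cmat (X * V) + cmat (W * V2)"
        using X V W V2 by (intro eq_matI) auto
      also have "\<dots> *\<^sub>v v = cmat X *\<^sub>v \<omega> + cmat W *\<^sub>v \<zeta>"
        using X V W V2 v cmat_mult_vec[OF X V v(1)] cmat_mult_vec[OF W V2 v(1)]
        by (simp add: add_mult_distrib_mat_vec[of _ n n] \<omega>_def \<zeta>_def)
      also have "\<dots> = cmat X *\<^sub>v \<omega>" using True W X \<omega> by (simp add: mult_vec_zero[of _ n])
      finally have v_eq: "v = cmat X *\<^sub>v \<omega>" .
      define h where "h = cmat H *\<^sub>v \<omega>"
      have h: "h \<in> carrier_vec m" using H \<omega> by (simp add: h_def)
      define g where "g = cmat (H\<^sup>T) *\<^sub>v h"
      have g: "g \<in> carrier_vec n1" using H h by (simp add: g_def)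
      have Av: "cmat A *\<^sub>v v = cmat X *\<^sub>v (cmat \<Phi> *\<^sub>v \<omega>)"
        unfolding v_eq using cmat_mult_vec[OF A X \<omega>] cmat_mult_vec[OF X \<Phi> \<omega>] by (simp add: AX)
      have Cv: "cmat C *\<^sub>v v = cmat K *\<^sub>v h"
        unfolding v_eq h_def using cmat_mult_vec[OF C X \<omega>] cmat_mult_vec[OF K H \<omega>] by (simp add: CX)
      have "cmat L *\<^sub>v (cmat C *\<^sub>v v) = cmat (L * (C * X)) *\<^sub>v \<omega>"
        unfolding v_eq using L C X \<omega> by (simp add: cmat_mult_vec[of _ n m _ n1] cmat_mult_vec[of _ m n _ n1])
      also have "\<dots> = cmat X *\<^sub>v (cmat \<Phi> *\<^sub>v g)"
        unfolding LCX g_def h_def using X \<Phi> H \<omega>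
        by (simp add: cmat_mult_vec[of _ n n1 _ n1] cmat_mult_vec[of _ n1 n1 _ n1] cmat_mult_vec[of _ n1 m _ n1])
      finally have LCv: "cmat L *\<^sub>v (cmat C *\<^sub>v v) = cmat X *\<^sub>v (cmat \<Phi> *\<^sub>v g)" .
      have "cmat X *\<^sub>v (\<mu> \<cdot>\<^sub>v \<omega>) = M *\<^sub>v v"
        using X \<omega> by (simp add: Mv mult_mat_vec[of _ n n1] flip: v_eq)
      also have "\<dots> = cmat X *\<^sub>v (cmat \<Phi> *\<^sub>v (\<omega> + (\<nu> - 1) \<cdot>\<^sub>v g))"
        unfolding M_mult[OF v(1)] Av LCv using X \<Phi> \<omega> g
        by (simp add: mult_add_distrib_mat_vec[of _ n n1] mult_add_distrib_mat_vec[of _ n1 n1]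
            mult_mat_vec[of _ n n1] mult_mat_vec[of _ n1 n1])
      finally have X_eq: "cmat X *\<^sub>v (\<mu> \<cdot>\<^sub>v \<omega>) = cmat X *\<^sub>v (cmat \<Phi> *\<^sub>v (\<omega> + (\<nu> - 1) \<cdot>\<^sub>v g))" .
      \<comment> \<open>The left inverse of \<open>X\<close> turns the eigenvector equation in the
        large space into one for the coordinates \<open>\<omega>\<close>.\<close>
      have cancel: "cmat V *\<^sub>v (cmat X *\<^sub>v w) = w" if "w \<in> carrier_vec n1" for w
        using cmat_mult_vec[OF V X that] that by (simp add: VX of_real_hom.mat_hom_one)
      have "cmat \<Phi> *\<^sub>v (\<omega> + (\<nu> - 1) \<cdot>\<^sub>v g) = \<mu> \<cdot>\<^sub>v \<omega>"
        using arg_cong[OF X_eq, of "\<lambda>w. cmat V *\<^sub>v w"] cancel \<omega> g \<Phi> by simp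
      then have h0: "h = 0\<^sub>v m"
        unfolding g_def h_def
        using contracted_rotation_eigenvector[OF \<Phi> \<Phi>_orth H H_orth \<omega> \<nu> \<mu>] by simp
      \<comment> \<open>The factorization \<open>C * X = K * H\<close> turns vanishing of
        \<open>h\<close> into vanishing output, which removes the feedback from the equation for
        \<open>v\<close>.\<close>
      have Cv0: "cmat C *\<^sub>v v = 0\<^sub>v m"
using K by (simp add: Cv h0 mult_vec_zero[of _ m])
      have "cmat A *\<^sub>v v = \<mu> \<cdot>\<^sub>v v"
        using Mv CAv(1) L by (simp add: M_mult[OF v(1)] Cv0 mult_vec_zero[of _ n])
      then have "v = 0\<^sub>v n"
        using detectable_eigenvector_in_kernel[OF A C detect v(1) _ \<mu> Cv0] by simp
      with v(2) show False by simp
    qed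
  qed
qed

section \<open>Inverses and block diagonalization\<close>

lemma mat_inv_inverse:
  assumes A: "A \<in> carrier_mat n n" and det: "det A \<noteq> 0"
  shows "mat_inv A \<in> carrier_mat n n" "A * mat_inv A = 1\<^sub>m n" "mat_inv A * A = 1\<^sub>m n"
proof -
  obtain B where "mat_inverse A = Some B"
    using mat_inverse(1)[OF A, of "()"] det_non_zero_imp_unit[OF A det, of "()"]
    by (cases "mat_inverse A") auto
  then show "mat_inv A \<in> carrier_mat n n" "A * mat_inv A = 1\<^sub>m n" "mat_inv A * A = 1\<^sub>m n"
    using mat_inverse(2)[OF A] by (auto simp: mat_inv_def)
qed

lemma det_nonzero_if_injective:
  fixes A :: "'a :: field mat"
  assumes "A \<in> carrier_mat n n" "\<And>v. v \<in> carrier_vec n \<Longrightarrow> A *\<^sub>v v = 0\<^sub>v n \<Longrightarrow> v = 0\<^sub>v n"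
  shows "det A \<noteq> 0"
  using assms by (auto simp: det_0_iff_vec_prod_zero_field)

lemma det_nonzero_if_invertible_mat:
  fixes A :: "'a :: field mat"
  assumes A: "A \<in> carrier_mat n n" and "invertible_mat A"
  shows "det A \<noteq> 0"
proof -
  obtain B where B: "A * B = 1\<^sub>m n" "B * A = 1\<^sub>m (dim_row B)"
    using assms by (auto simp: invertible_mat_def inverts_mat_def)
  have "B \<in> carrier_mat n n"
    using arg_cong[OF B(1), of dim_col] arg_cong[OF B(2), of dim_col] A by auto
  then have "det A * det B = 1" using arg_cong[OF B(1), of det] A by (simp add: det_mult)
  then show ?thesis by auto
qed

lemma four_block_mat_inject:
  assumes "A \<in> carrier_mat nr1 nc1" "B \<in> carrier_mat nr1 nc2" "C \<in> carrier_mat nr2 nc1" "D \<in> carrier_mat nr2 nc2"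
    and "A' \<in> carrier_mat nr1 nc1" "B' \<in> carrier_mat nr1 nc2" "C' \<in> carrier_mat nr2 nc1" "D' \<in> carrier_mat nr2 nc2"
    and eq: "four_block_mat A B C D = four_block_mat A' B' C' D'"
  shows "A = A'" "B = B'" "C = C'" "D = D'"
proof -
  have entry: "four_block_mat A B C D $$ (i, j) = four_block_mat A' B' C' D' $$ (i, j)" for i j
    by (simp add: eq)
  show "A = A'"
  proof (rule eq_matI)
    show "A $$ (i, j) = A' $$ (i, j)" if "i < dim_row A'" "j < dim_col A'" for i j
      using entry[of i j] assms(1-8) that by auto
  qed (use assms(1-8) in auto)
  show "B = B'"
  proof (rule eq_matI)
    show "B $$ (i, j) = B' $$ (i, j)" if "i < dim_row B'" "j < dim_col B'" for i j
      using entry[of i "j + nc1"] assms(1-8) that by auto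
  qed (use assms(1-8) in auto)
  show "C = C'"
  proof (rule eq_matI)
    show "C $$ (i, j) = C' $$ (i, j)" if "i < dim_row C'" "j < dim_col C'" for i j
      using entry[of "i + nr1" j] assms(1-8) that by auto
  qed (use assms(1-8) in auto)
  show "D = D'"
  proof (rule eq_matI)
    show "D $$ (i, j) = D' $$ (i, j)" if "i < dim_row D'" "j < dim_col D'" for i j
      using entry[of "i + nr1" "j + nc1"] assms(1-8) that by auto
  qed (use assms(1-8) in auto)
qed

text \<open>\<open>V\<close> and \<open>V2\<close> are the upper and lower rows of the inverse of
  \<open>T = append_cols U W\<close>. All identities result from comparing blocks in the two inverse
  equations, in \<open>A * T = T * D\<close> and in \<open>Ti * A = D * Ti\<close>.\<close>

lemma block_diagonalization_coordinates:
  assumes A: "A \<in> carrier_mat n n" and U: "U \<in> carrier_mat n n1" and W: "W \<in> carrier_mat n n2"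
    and F: "F \<in> carrier_mat n1 n1" and G: "G \<in> carrier_mat n2 n2"
    and inv: "invertible_mat (append_cols U W)"
    and eq: "mat_inv (append_cols U W) * A * append_cols U W = four_block_mat F (0\<^sub>m n1 n2) (0\<^sub>m n2 n1) G"
  obtains V V2 where "V \<in> carrier_mat n1 n" "V2 \<in> carrier_mat n2 n"
    "V * U = 1\<^sub>m n1" "V2 * U = 0\<^sub>m n2 n1" "U * V + W * V2 = 1\<^sub>m n"
    "A * U = U * F" "V2 * A = G * V2"
    "similar_mat A (four_block_mat F (0\<^sub>m n1 n2) (0\<^sub>m n2 n1) G)"
proof -
  define T where "T = append_cols U W"
  define D where "D = four_block_mat F (0\<^sub>m n1 n2) (0\<^sub>m n2 n1) G"
  have "square_mat T" using inv by (simp add: T_def invertible_mat_def)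
  then have n12: "n1 + n2 = n" using U W by (simp add: T_def append_cols_def)
  have T_eq: "T = four_block_mat U W (0\<^sub>m 0 n1) (0\<^sub>m 0 n2)" using U W by (simp add: T_def append_cols_def)
  have "T \<in> carrier_mat (n + 0) (n1 + n2)"
    unfolding T_eq by (rule four_block_carrier_mat) (use U in auto)
  then have T: "T \<in> carrier_mat n n" using n12 by simp
  have D: "D \<in> carrier_mat n n" using four_block_carrier_mat[OF F G] n12 by (simp add: D_def)
  define Ti where "Ti = mat_inv T"
  have det: "det T \<noteq> 0" using det_nonzero_if_invertible_mat[OF T] inv by (simp add: T_def)
  note Ti = mat_inv_inverse[OF T det, folded Ti_def]
  have Ti_A_T: "Ti * A * T = D" using eq by (simp add: Ti_def T_def D_def)
  have "Ti * (A * T) = D" using Ti_A_T Ti A T by (simp add: assoc_mult_mat[of _ n n _ n _ n])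
  then have AT: "A * T = T * D"
    using mult_mat_left_cancel[OF T Ti(1) _ Ti(2), of "A * T" n] A T by simp
  have TiA: "Ti * A = D * Ti"
    unfolding Ti_A_T[symmetric] using Ti A T by (simp add: assoc_mult_mat[of _ n n _ n _ n])
  define V where "V = mat n1 n (\<lambda>(i, j). Ti $$ (i, j))"
  define V2 where "V2 = mat n2 n (\<lambda>(i, j). Ti $$ (i + n1, j))"
  have V: "V \<in> carrier_mat n1 n" and V2: "V2 \<in> carrier_mat n2 n" by (auto simp: V_def V2_def)
  \<comment> \<open>Empty blocks pad \<open>Ti\<close>, and then \<open>A\<close>, to the two-by-two
    block shape that \<open>append_cols\<close> already gives \<open>T\<close>, so that every
    product can be computed blockwise.\<close>
  have Ti_eq: "Ti = four_block_mat V (0\<^sub>m n1 0) V2 (0\<^sub>m n2 0)"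
    using Ti(1) n12 by (intro eq_matI) (auto simp: V_def V2_def)
  have A_eq: "A = four_block_mat A (0\<^sub>m n 0) (0\<^sub>m 0 n) (0\<^sub>m 0 0)"
    using A by (intro eq_matI) auto
  have "Ti * T = four_block_mat (V * U) (V * W) (V2 * U) (V2 * W)"
    unfolding T_eq Ti_eq using U W V V2
    by (subst mult_four_block_mat[of _ n1 n _ 0 _ n2 _ _ n1 _ n2]) auto
  also have "Ti * T = four_block_mat (1\<^sub>m n1) (0\<^sub>m n1 n2) (0\<^sub>m n2 n1) (1\<^sub>m n2)"
    using Ti n12 by simp
  finally have "four_block_mat (V * U) (V * W) (V2 * U) (V2 * W)
      = four_block_mat (1\<^sub>m n1) (0\<^sub>m n1 n2) (0\<^sub>m n2 n1) (1\<^sub>m n2)" by simp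
  note VU = four_block_mat_inject[OF _ _ _ _ _ _ _ _ this, of n1 n1 n2 n2]
  have "T * Ti = four_block_mat (U * V + W * V2) (0\<^sub>m n 0) (0\<^sub>m 0 n) (0\<^sub>m 0 0)"
    unfolding T_eq Ti_eq using U W V V2
    by (subst mult_four_block_mat[of _ n n1 _ n2 _ 0 _ _ n _ 0]) auto
  moreover have "four_block_mat (U * V + W * V2) (0\<^sub>m n 0) (0\<^sub>m 0 n) (0\<^sub>m 0 0) = U * V + W * V2"
    using U W V V2 by (intro eq_matI) auto
  ultimately have UV: "U * V + W * V2 = 1\<^sub>m n" using Ti by simp
  have "A * T = four_block_mat (A * U) (A * W) (0\<^sub>m 0 n1) (0\<^sub>m 0 n2)"
    unfolding T_eq by (subst A_eq) (use A U W in \<open>subst mult_four_block_mat[of _ n n _ 0 _ 0 _ _ n1 _ n2], auto\<close>)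
  moreover have "T * D = four_block_mat (U * F) (W * G) (0\<^sub>m 0 n1) (0\<^sub>m 0 n2)"
    unfolding T_eq D_def using F G U W by (subst mult_four_block_mat[of _ n n1 _ n2 _ 0 _ _ n1 _ n2]) auto
  ultimately have "four_block_mat (A * U) (A * W) (0\<^sub>m 0 n1) (0\<^sub>m 0 n2)
      = four_block_mat (U * F) (W * G) (0\<^sub>m 0 n1) (0\<^sub>m 0 n2)" using AT by simp
  note AU = four_block_mat_inject(1)[OF _ _ _ _ _ _ _ _ this, of n n1 n2 0]
  have "Ti * A = four_block_mat (V * A) (0\<^sub>m n1 0) (V2 * A) (0\<^sub>m n2 0)"
    unfolding Ti_eq by (subst A_eq) (use A V V2 in \<open>subst mult_four_block_mat[of _ n1 n _ 0 _ n2 _ _ n _ 0], auto\<close>)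
  moreover have "D * Ti = four_block_mat (F * V) (0\<^sub>m n1 0) (G * V2) (0\<^sub>m n2 0)"
    unfolding Ti_eq D_def using F G V V2 by (subst mult_four_block_mat[of _ n1 n1 _ n2 _ n2 _ _ n _ 0]) auto
  ultimately have "four_block_mat (V * A) (0\<^sub>m n1 0) (V2 * A) (0\<^sub>m n2 0)
      = four_block_mat (F * V) (0\<^sub>m n1 0) (G * V2) (0\<^sub>m n2 0)" using TiA by simp
  note V2A = four_block_mat_inject(3)[OF _ _ _ _ _ _ _ _ this, of n1 n 0 n2]
  have "A = T * D * Ti"
    unfolding Ti_A_T[symmetric] using A T Ti
    by (simp add: assoc_mult_mat[of _ n n _ n _ n] mult_mat_left_cancel[of T n n Ti _ n])
  then have "similar_mat A D"
    unfolding similar_mat_def similar_mat_wit_def Let_def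
    by (intro exI[of _ T] exI[of _ Ti]) (use A D T Ti in auto)
  then show thesis
    using that[OF V V2 VU(1) VU(3) UV AU V2A] A U W V V2 F G by (simp add: D_def)
qed

section \<open>Counting eigenvalues on the unit circle\<close>

lemma sum_order_complex_roots:
  fixes q :: "complex poly"
  assumes "q \<noteq> 0"
  shows "(\<Sum>\<mu> | poly q \<mu> = 0. Polynomial.order \<mu> q) = degree q"
  using size_proots_complex[of q] assms by (simp add: size_multiset_overloaded_eq)

text \<open>A multiplicity count: the characteristic polynomial of \<open>A\<close> is the product
  of those of \<open>F\<close> and \<open>G\<close>, and its roots on the unit circle number
  \<open>n1\<close>. The block \<open>F\<close> already supplies \<open>n1\<close> of them, so none
  is left for \<open>G\<close>, and neutral stability excludes larger moduli.\<close>

lemma schur_stable_complementary_block: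
  assumes A: "A \<in> carrier_mat n n" and neutral: "neutrally_stable A"
    and F: "F \<in> carrier_mat n1 n1" and G: "G \<in> carrier_mat n2 n2"
    and sim: "similar_mat A (four_block_mat F (0\<^sub>m n1 n2) (0\<^sub>m n2 n1) G)"
    and num: "n1 = num_unit_eigenvalues A" and F_unit: "\<forall>\<mu> \<in> spectrum (cmat F). cmod \<mu> = 1"
  shows "schur_stable (cmat G)"
  unfolding schur_stable_def
proof (intro allI impI)
  fix \<mu> assume ev: "eigenvalue (cmat G) \<mu>"
  let ?a = "char_poly (cmat A)" and ?f = "char_poly (cmat F)" and ?g = "char_poly (cmat G)"
  have cA: "cmat A \<in> carrier_mat n n" and cF: "cmat F \<in> carrier_mat n1 n1" and cG: "cmat G \<in> carrier_mat n2 n2"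
    using A F G by auto
  have "?a = map_poly complex_of_real (char_poly A)"
    using of_real_hom.char_poly_hom[OF A] by simp
  also have "char_poly A = char_poly (four_block_mat F (0\<^sub>m n1 n2) (0\<^sub>m n2 n1) G)"
    using char_poly_similar[OF sim] .
  also have "map_poly complex_of_real \<dots> = char_poly (cmat (four_block_mat F (0\<^sub>m n1 n2) (0\<^sub>m n2 n1) G))"
    by (rule of_real_hom.char_poly_hom[OF four_block_carrier_mat[OF F G], symmetric])
  also have "cmat (four_block_mat F (0\<^sub>m n1 n2) (0\<^sub>m n2 n1) G)
      = four_block_mat (cmat F) (0\<^sub>m n1 n2) (0\<^sub>m n2 n1) (cmat G)"
    using F G by (intro eq_matI) auto
  also have "char_poly \<dots> = ?f * ?g"
    using char_poly_factorized[OF cF] char_poly_factorized[OF cG] cF cG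
    by (intro char_poly_0_block) auto
  finally have a: "?a = ?f * ?g" .
  have nz: "?f \<noteq> 0" "?g \<noteq> 0" "?a \<noteq> 0"
    using degree_monic_char_poly[OF cF] degree_monic_char_poly[OF cG] degree_monic_char_poly[OF cA] by auto
  note spec = spectrum_root_char_poly[OF cA] spectrum_root_char_poly[OF cF]
  define Z where "Z = {\<mu> \<in> spectrum (cmat A). cmod \<mu> = 1}"
  have fin: "finite Z" unfolding Z_def spec using poly_roots_finite[OF nz(3)] by auto
  have roots_f: "{\<mu>. poly ?f \<mu> = 0} \<subseteq> Z"
    using F_unit unfolding Z_def spec a by auto
  \<comment> \<open>The orders add over the factorization. The share of \<open>F\<close> is the
    degree \<open>n1\<close>, so the orders contributed by \<open>G\<close> sum to zero and each of
    them vanishes.\<close>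
  have "n1 = (\<Sum>\<mu>\<in>Z. Polynomial.order \<mu> ?f + Polynomial.order \<mu> ?g)"
    unfolding num num_unit_eigenvalues_def Z_def[symmetric] a
    using nz by (intro sum.cong) (auto simp: order_mult a)
  also have "\<dots> = (\<Sum>\<mu>\<in>Z. Polynomial.order \<mu> ?f) + (\<Sum>\<mu>\<in>Z. Polynomial.order \<mu> ?g)"
    by (rule sum.distrib)
  also have "(\<Sum>\<mu>\<in>Z. Polynomial.order \<mu> ?f) = (\<Sum>\<mu> | poly ?f \<mu> = 0. Polynomial.order \<mu> ?f)"
    by (rule sum.mono_neutral_right[OF fin roots_f]) (use nz in \<open>auto simp: order_root\<close>)
  also have "\<dots> = n1" using sum_order_complex_roots[OF nz(1)] degree_monic_char_poly[OF cF] by simp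
  finally have "\<forall>\<mu>\<in>Z. Polynomial.order \<mu> ?g = 0" using fin by simp
  moreover have "poly ?g \<mu> = 0" using ev by (simp add: eigenvalue_root_char_poly[OF cG])
  moreover from this have "\<mu> \<in> spectrum (cmat A)" unfolding spec a by simp
  ultimately have "cmod \<mu> \<noteq> 1" using nz(2) by (auto simp: Z_def order_root)
  moreover have "cmod \<mu> \<le> 1"
    using neutral \<open>\<mu> \<in> spectrum (cmat A)\<close> by (auto simp: neutrally_stable_def spectrum_def)
  ultimately show "cmod \<mu> < 1" by simp
qed

text \<open>Every eigenvalue is a root of positive order, so a zero count leaves none on the unit
  circle.\<close>

lemma schur_stable_if_no_unit_eigenvalues:
  assumes A: "A \<in> carrier_mat n n" and neutral: "neutrally_stable A" and num: "num_unit_eigenvalues A = 0"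
  shows "schur_stable (cmat A)"
  unfolding schur_stable_def
proof (intro allI impI)
  fix \<mu> assume ev: "eigenvalue (cmat A) \<mu>"
  have cA: "cmat A \<in> carrier_mat n n" using A by auto
  have nz: "char_poly (cmat A) \<noteq> 0" using degree_monic_char_poly[OF cA] by auto
  have "finite (spectrum (cmat A))" using card_finite_spectrum[OF cA] by simp
  with num have "\<forall>\<mu> \<in> spectrum (cmat A). cmod \<mu> = 1 \<longrightarrow> Polynomial.order \<mu> (char_poly (cmat A)) = 0"
    by (auto simp: num_unit_eigenvalues_def)
  then have "cmod \<mu> \<noteq> 1"
    using ev nz by (auto simp: spectrum_def eigenvalue_root_char_poly[OF cA] order_root)
  with neutral ev show "cmod \<mu> < 1" by (force simp: neutrally_stable_def)
qed

text \<open>Full row rank makes \<open>X\<close> surjective. Writing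
  \<open>v = X *\<^sub>v w\<close> and moving \<open>X\<close> to the other side of the scalar
  product shows that \<open>v\<close> is orthogonal to itself.\<close>

lemma full_row_rank_transpose_injective:
  fixes X :: "real mat"
  assumes X: "X \<in> carrier_mat m k" and rank: "vec_space.rank m X = m"
    and v: "v \<in> carrier_vec m" and ker: "X\<^sup>T *\<^sub>v v = 0\<^sub>v k"
  shows "v = 0\<^sub>v m"
proof -
  interpret vec_space "TYPE(real)" m .
  \<comment> \<open>A maximal independent set of columns has as many elements as the rank, here
    \<open>m\<close>, and is therefore a basis of the whole space.\<close>
  obtain S where S: "maximal S (\<lambda>T. T \<subseteq> set (cols X) \<and> lin_indpt T)"
    using maximal_exists[of "(\<lambda>T. T \<subseteq> set (cols X) \<and> lin_indpt T)" "card (set (cols X))" "{}"]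
    by (meson List.finite_set card_mono empty_iff empty_subsetI finite_lin_indpt2 rev_finite_subset)
  have card: "card S = m" using rank_card_indpt[OF X S] rank by simp
  have S_sub: "S \<subseteq> set (cols X)" and li: "lin_indpt S" using S by (auto simp: maximal_def)
  have cols: "set (cols X) \<subseteq> carrier_vec m" using X cols_dim by blast
  have "basis S"
    using dim_li_is_basis[of S] S_sub li card cols fin_dim finite_subset[OF S_sub] dim_is_n by auto
  then have "v \<in> span S" using v by (simp add: basis_def)
  then have "v \<in> col_space X" unfolding col_space_def using span_is_monotone[OF S_sub] by blast
  then obtain w where w: "w \<in> carrier_vec k" "v = X *\<^sub>v w" using col_space_eq[OF X] X by auto
  have "v \<bullet> v = v \<bullet> (X *\<^sub>v w)" using w by simp
  also have "\<dots> = (X\<^sup>T *\<^sub>v v) \<bullet> w" using transpose_vec_mult_scalar[OF X w(1) v] by simp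
  also have "\<dots> = 0" using w ker by simp
  finally show ?thesis using v conjugate_square_eq_0_vec[OF v] by simp
qed

lemma sym_pos_def_det_nonzero:
  assumes "sym_pos_def n Q"
  shows "det Q \<noteq> 0"
proof (rule det_nonzero_if_injective)
  show "Q \<in> carrier_mat n n" using assms by (simp add: sym_pos_def_def)
  show "v = 0\<^sub>v n" if "v \<in> carrier_vec n" "Q *\<^sub>v v = 0\<^sub>v n" for v
    using assms that by (auto simp: sym_pos_def_def)
qed

text \<open>Rescaling the basis \<open>U\<close> by the inverse square root \<open>S\<close> of
  \<open>R\<close> yields the required coordinates: \<open>F\<close> becomes orthogonal, and
  \<open>C\<close> on the rescaled basis factors as \<open>K * H\<close> with \<open>K\<close>
  invertible. The gain \<open>L\<close> inverts exactly this \<open>K\<close>.\<close>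

lemma coupled_mode_schur_stable:
  assumes A: "A \<in> carrier_mat n n" and C: "C \<in> carrier_mat m n"
    and neutral: "neutrally_stable A" and detect: "detectable n m C A"
    and gain: "sync_gain n m A C L" and \<nu>: "cmod \<nu> < 1"
  shows "L \<in> carrier_mat n m \<and> schur_stable (cmat (A - L * C) + \<nu> \<cdot>\<^sub>m cmat (L * C))"
proof (cases "num_unit_eigenvalues A = 0")
  case True
  then have L: "L = 0\<^sub>m n m" using gain by (simp add: sync_gain_def)
  have "cmat (A - L * C) + \<nu> \<cdot>\<^sub>m cmat (L * C) = cmat A"
    unfolding L using A C by (intro eq_matI) auto
  then show ?thesis using schur_stable_if_no_unit_eigenvalues[OF A neutral True] L by simp
next
  case False
  define n1 where "n1 = num_unit_eigenvalues A"
  define n2 where "n2 = n - n1"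
  obtain U W F G R Q S H where
    U: "U \<in> carrier_mat n n1" and W: "W \<in> carrier_mat n n2" and F: "F \<in> carrier_mat n1 n1"
    and G: "G \<in> carrier_mat n2 n2" and H: "H \<in> carrier_mat m n1"
    and inv: "invertible_mat (append_cols U W)"
    and diag: "mat_inv (append_cols U W) * A * append_cols U W = four_block_mat F (0\<^sub>m n1 n2) (0\<^sub>m n2 n1) G"
    and F_unit: "\<forall>\<mu> \<in> spectrum (cmat F). cmod \<mu> = 1"
    and rank: "vec_space.rank m (C * U) = m"
    and R: "sym_pos_def n1 R" "F\<^sup>T * R * F = R"
    and Q: "is_spd_sqrt n1 R Q" and S_def: "S = mat_inv Q"
    and col: "vec_space.col_space n1 (H\<^sup>T) = vec_space.col_space n1 (S * U\<^sup>T * C\<^sup>T)"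
    and HH: "H * H\<^sup>T = 1\<^sub>m m"
    and L_def: "L = U * F * S * H\<^sup>T * mat_inv (C * U * S * H\<^sup>T)"
    using gain False unfolding sync_gain_def Let_def n1_def[symmetric] n2_def[symmetric] by auto
  have Q_spd: "sym_pos_def n1 Q" and QQ: "Q * Q = R" using Q by (auto simp: is_spd_sqrt_def)
  then have Qc: "Q \<in> carrier_mat n1 n1" and Q_sym: "Q\<^sup>T = Q" by (auto simp: sym_pos_def_def)
  note S = mat_inv_inverse[OF Qc sym_pos_def_det_nonzero[OF Q_spd], folded S_def]
  note [simp] = assoc_mult_mat[of _ n1 n1 _ n1 _ n1]
  have "S\<^sup>T * Q = 1\<^sub>m n1"
    using arg_cong[OF S(2), of transpose_mat] Qc S(1) Q_sym by (simp add: transpose_mult[of _ n1 n1])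
  then have S_sym: "S\<^sup>T = S"
    using mult_mat_left_cancel[of "S\<^sup>T" n1 n1 Q S n1] Qc S by simp

  define Y where "Y = S * U\<^sup>T * C\<^sup>T"
  define K where "K = C * U * S * H\<^sup>T"
  have Y: "Y \<in> carrier_mat n1 m" and K: "K \<in> carrier_mat m m"
    using S U C H by (auto simp: Y_def K_def)
  have YT: "Y\<^sup>T = C * (U * S)"
    unfolding Y_def using S U C S_sym
    by (simp add: transpose_mult[of _ n1 n _ m] transpose_mult[of _ n1 n1 _ m] assoc_mult_mat[of _ n1 n1 _ n _ m]
        assoc_mult_mat[of _ m n _ n1 _ n1])
  have YT': "C * U * S = Y\<^sup>T" using YT S U C by (simp add: assoc_mult_mat[of _ m n _ n1 _ n1])
  \<comment> \<open>The condition on the column spaces enters here, as membership of each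
    \<open>Y *\<^sub>v v\<close> in the range of \<open>H\<^sup>T\<close>.\<close>
  have Y_in: "\<exists>w \<in> carrier_vec m. Y *\<^sub>v v = H\<^sup>T *\<^sub>v w" if v: "v \<in> carrier_vec m" for v
  proof -
    interpret vec_space "TYPE(real)" n1 .
    have "Y *\<^sub>v v \<in> col_space Y" using v Y col_space_eq[OF Y] by auto
    then have "Y *\<^sub>v v \<in> col_space (H\<^sup>T)" unfolding Y_def col .
    then obtain w where "w \<in> carrier_vec m" "H\<^sup>T *\<^sub>v w = Y *\<^sub>v v"
      using col_space_eq[of "H\<^sup>T" m] H by auto
    then show ?thesis by metis
  qed
  \<comment> \<open>Consequently \<open>H\<^sup>T * H\<close> fixes the range of
    \<open>H\<^sup>T\<close>, and with it every column of \<open>Y\<close>.\<close>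
  have HHT: "H *\<^sub>v (H\<^sup>T *\<^sub>v w) = w" if "w \<in> carrier_vec m" for w
    using mult_mat_vec_left_cancel[of H m n1 "H\<^sup>T" w] H HH that by simp
  have "H\<^sup>T * (H * Y) = Y"
  proof (rule eq_matI)
    fix i j assume ij: "i < dim_row Y" "j < dim_col Y"
    obtain w where w: "w \<in> carrier_vec m" "Y *\<^sub>v unit_vec m j = H\<^sup>T *\<^sub>v w" using Y_in[of "unit_vec m j"] by auto
    have colY: "col Y j = H\<^sup>T *\<^sub>v w"
      unfolding w(2)[symmetric] using ij Y by (intro eq_vecI) (auto simp: scalar_prod_right_unit[of _ m])
    have colHY: "col (H * Y) j = H *\<^sub>v col Y j"
      using H Y ij by (intro col_mult2[of _ m n1 _ m]) auto
    have "col (H\<^sup>T * (H * Y)) j = H\<^sup>T *\<^sub>v (H *\<^sub>v col Y j)"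
      unfolding colHY[symmetric] using H Y ij by (intro col_mult2[of _ n1 m _ m]) auto
    also have "\<dots> = col Y j" unfolding colY using HHT[OF w(1)] by simp
    finally have "col (H\<^sup>T * (H * Y)) j $ i = col Y j $ i" by simp
    then show "(H\<^sup>T * (H * Y)) $$ (i, j) = Y $$ (i, j)" using ij H Y by simp
  qed (use H Y in auto)
  from arg_cong[OF this, of transpose_mat] have YTHH: "Y\<^sup>T * H\<^sup>T * H = Y\<^sup>T"
    using H Y by (simp add: transpose_mult[of _ n1 m _ m] transpose_mult[of _ m n1 _ m])
  have K_YT: "K = Y\<^sup>T * H\<^sup>T" unfolding K_def YT' ..
  then have KH: "K * H = Y\<^sup>T" using YTHH by simp
  have "det (K\<^sup>T) \<noteq> 0"
  proof (rule det_nonzero_if_injective)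
    \<comment> \<open>Since \<open>Y *\<^sub>v v\<close> is \<open>H\<^sup>T *\<^sub>v w\<close> and
      \<open>H\<close> recovers \<open>w\<close>, a kernel vector \<open>v\<close> of
      \<open>K\<^sup>T\<close> has \<open>w = 0\<close>. Then invertibility of \<open>S\<close> and
      full row rank of \<open>C * U\<close> give \<open>v = 0\<close>.\<close>
    fix v assume v: "v \<in> carrier_vec m" and ker: "K\<^sup>T *\<^sub>v v = 0\<^sub>v m"
    have "K\<^sup>T = H * Y" unfolding K_YT using H Y by (simp add: transpose_mult[of _ m n1 _ m])
    then have HYv: "H *\<^sub>v (Y *\<^sub>v v) = 0\<^sub>v m" using ker H Y v by simp
    obtain w where w: "w \<in> carrier_vec m" "Y *\<^sub>v v = H\<^sup>T *\<^sub>v w" using Y_in[OF v] by auto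
    then have "w = 0\<^sub>v m" using HYv HHT[OF w(1)] by simp
    then have "Y *\<^sub>v v = 0\<^sub>v n1" using w(2) H by (simp add: mult_vec_zero[of _ n1])
    then have "S *\<^sub>v ((C * U)\<^sup>T *\<^sub>v v) = 0\<^sub>v n1"
      unfolding Y_def using S U C v
      by (simp add: transpose_mult[of _ m n _ n1] assoc_mult_mat_vec[of _ n1 n _ m] assoc_mult_mat_vec[of _ n1 n1 _ n]
          assoc_mult_mat[of _ n1 n1 _ n _ m] assoc_mult_mat_vec[of _ n1 n1 _ m])
    moreover have "(C * U)\<^sup>T *\<^sub>v v \<in> carrier_vec n1" using U by (auto intro: carrier_vecI)
    ultimately have "(C * U)\<^sup>T *\<^sub>v v = 0\<^sub>v n1"
      using mult_mat_vec_left_cancel[of Q n1 n1 S "(C * U)\<^sup>T *\<^sub>v v"] Qc S U C v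
      by (simp add: mult_vec_zero[of _ n1])
    then show "v = 0\<^sub>v m"
      using full_row_rank_transpose_injective[OF mult_carrier_mat[OF C U] rank v] by simp
  qed (use K in simp)
  then have "det K \<noteq> 0" using det_transpose[OF K] by simp
  note Ki = mat_inv_inverse[OF K this]

  obtain V V2 where V: "V \<in> carrier_mat n1 n" and V2: "V2 \<in> carrier_mat n2 n"
    and VU: "V * U = 1\<^sub>m n1" and V2U: "V2 * U = 0\<^sub>m n2 n1" and UV: "U * V + W * V2 = 1\<^sub>m n"
    and AU: "A * U = U * F" and V2A: "V2 * A = G * V2"
    and sim: "similar_mat A (four_block_mat F (0\<^sub>m n1 n2) (0\<^sub>m n2 n1) G)"
    using block_diagonalization_coordinates[OF A U W F G inv diag] by metis
  \<comment> \<open>In these coordinates the inner product defined by \<open>R\<close> becomes the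
    standard one, and \<open>\<Phi>\<close> represents \<open>F\<close>.\<close>
  define X where "X = U * S"
  define \<Phi> where "\<Phi> = Q * (F * S)"
  define Vs where "Vs = Q * V"
  have X: "X \<in> carrier_mat n n1" and \<Phi>: "\<Phi> \<in> carrier_mat n1 n1" and Vs: "Vs \<in> carrier_mat n1 n"
    using U S Qc F V by (auto simp: X_def \<Phi>_def Vs_def)
  have S_Q: "S * (Q * B) = B" if "B \<in> carrier_mat n1 q" for B q
    using mult_mat_left_cancel[OF S(1) Qc that S(3)] .
  have Q_S: "Q * (S * B) = B" if "B \<in> carrier_mat n1 q" for B q
    using mult_mat_left_cancel[OF Qc S(1) that S(2)] .
  have XVs: "X * Vs = U * V"
    using U S Qc V by (simp add: X_def Vs_def assoc_mult_mat[of _ n n1 _ n1 _ n] S_Q[of _ n])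
  have VsX: "Vs * X = 1\<^sub>m n1"
  proof -
    have "Vs * X = Q * ((V * U) * S)"
      using U S Qc V by (simp add: X_def Vs_def assoc_mult_mat[of _ n1 n1 _ n _ n1] assoc_mult_mat[of _ n1 n _ n1 _ n1])
    then show ?thesis using S by (simp add: VU)
  qed
  have UFS: "U * F * S = X * \<Phi>"
    using U F S Qc by (simp add: X_def \<Phi>_def assoc_mult_mat[of _ n n1 _ n1 _ n1] S_Q[of _ n1])
  have AX: "A * X = X * \<Phi>"
    using UFS AU A U S by (simp add: X_def assoc_mult_mat[of _ n n _ n1 _ n1, symmetric])
  \<comment> \<open>Conjugation by the square root \<open>Q\<close> turns invariance of
    \<open>R\<close> under \<open>F\<close> into orthogonality.\<close>
  have \<Phi>_orth: "\<Phi>\<^sup>T * \<Phi> = 1\<^sub>m n1"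
  proof -
    have "\<Phi>\<^sup>T = S * (F\<^sup>T * Q)"
      using Qc F S by (simp add: \<Phi>_def transpose_mult[of _ n1 n1 _ n1] S_sym Q_sym)
    then have "\<Phi>\<^sup>T * \<Phi> = S * ((F\<^sup>T * (Q * Q) * F) * S)"
      using Qc F S by (simp add: \<Phi>_def)
    also have "F\<^sup>T * (Q * Q) * F = Q * Q" unfolding QQ using R(2) .
    also have "S * ((Q * Q) * S) = 1\<^sub>m n1" using Qc S by (simp add: S_Q[of _ n1])
    finally show ?thesis .
  qed
  have CX: "C * X = K * H" using YT KH by (simp add: X_def)
  define J where "J = \<Phi> * (H\<^sup>T * mat_inv K)"
  have J: "J \<in> carrier_mat n1 m" using \<Phi> H Ki by (simp add: J_def)
  have L_eq: "L = X * J"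
    unfolding L_def K_def[symmetric] UFS J_def using X \<Phi> H Ki
    by (simp add: assoc_mult_mat[of _ n n1 _ n1 _ m] assoc_mult_mat[of _ n n1 _ m _ m]
        assoc_mult_mat[of _ n1 n1 _ m _ m])
  have L: "L \<in> carrier_mat n m" using X J by (simp add: L_eq)
  have "V2 * X = (V2 * U) * S" using V2 U S by (simp add: X_def assoc_mult_mat[of _ n2 n _ n1 _ n1])
  then have V2X: "V2 * X = 0\<^sub>m n2 n1" using S by (simp add: V2U)
  have "V2 * L = (V2 * X) * J" using V2 X J by (simp add: L_eq assoc_mult_mat[of _ n2 n _ n1 _ m])
  then have V2L: "V2 * L = 0\<^sub>m n2 m" using J by (simp add: V2X)
  \<comment> \<open>The inverse of \<open>K\<close> in the gain cancels the factor \<open>K\<close>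
    of \<open>C * X\<close>, leaving the orthogonal projection \<open>H\<^sup>T * H\<close> followed
    by \<open>\<Phi>\<close>.\<close>
  have "L * (C * X) = X * (\<Phi> * (H\<^sup>T * (mat_inv K * (K * H))))"
    unfolding CX L_eq J_def using X \<Phi> H Ki K
    by (simp add: assoc_mult_mat[of _ n n1 _ m _ n1] assoc_mult_mat[of _ n1 n1 _ m _ n1]
        assoc_mult_mat[of _ n1 m _ m _ n1])
  also have "mat_inv K * (K * H) = H" using mult_mat_left_cancel[OF Ki(1) K H Ki(3)] .
  finally have LCX: "L * (C * X) = X * (\<Phi> * (H\<^sup>T * H))" .
  have G_stable: "schur_stable (cmat G)"
    using schur_stable_complementary_block[OF A neutral F G sim n1_def F_unit] .
  show ?thesis
    using coupled_mode_schur_stable_coordinates[OF A C L detect \<nu> X Vs W V2 \<Phi> G H K _ VsX V2A V2L AX LCX CX \<Phi>_orth HH G_stable]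
      UV XVs L by simp
qed

section \<open>Synchronization\<close>

lemma tendsto_norm2_0:
  assumes w: "\<And>k. w k \<in> carrier_vec n" and lim: "\<And>a. a < n \<Longrightarrow> (\<lambda>k. w k $ a) \<longlonglongrightarrow> 0"
  shows "(\<lambda>k. norm2 (w k)) \<longlonglongrightarrow> 0"
proof -
  have "(\<lambda>k. sqrt (\<Sum>a = 0..<n. w k $ a * w k $ a)) \<longlonglongrightarrow> sqrt (\<Sum>a = 0..<n. 0 * 0)"
    by (intro tendsto_intros lim) auto
  moreover have "norm2 (w k) = sqrt (\<Sum>a = 0..<n. w k $ a * w k $ a)" for k
    using w[of k] by (simp add: norm2_def scalar_prod_def)
  ultimately show ?thesis by simp
qed

lemma sum_lessThan_mult:
  fixes f :: "nat \<Rightarrow> 'a :: comm_monoid_add"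
  shows "sum f {..<p * n} = (\<Sum>j<p. \<Sum>b<n. f (j * n + b))"
proof -
  have "sum f {j * n..<j * n + n} = (\<Sum>b<n. f (j * n + b))" for j
    using sum.atLeastLessThan_shift_0[of f "j * n" "j * n + n"] by (simp add: lessThan_atLeast0)
  then show ?thesis unfolding sum.nat_group[symmetric] by simp
qed

text \<open>With \<open>B\<close> a power of \<open>A\<close>, this identifies the claimed limit
  trajectory with that power applied to the \<open>r\<close>-weighted mean of the initial states.
  The sum over \<open>l\<close> splits through \<open>l = j * n + b\<close>.\<close>

lemma kronecker_row_mult_stack_vec:
  assumes r: "r \<in> carrier_vec p" and B: "B \<in> carrier_mat n n" and v: "\<And>j. j < p \<Longrightarrow> v j \<in> carrier_vec n"
  shows "kronecker (mat_of_row r) B *\<^sub>v stack_vec p n v = B *\<^sub>v (mat n p (\<lambda>(a, j). v j $ a) *\<^sub>v r)"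
proof (rule eq_vecI)
  fix a assume "a < dim_vec (B *\<^sub>v (mat n p (\<lambda>(a, j). v j $ a) *\<^sub>v r))"
  then have a: "a < n" using B by simp
  have "(kronecker (mat_of_row r) B *\<^sub>v stack_vec p n v) $ a
      = (\<Sum>l<p * n. r $ (l div n) * B $$ (a, l mod n) * v (l div n) $ (l mod n))"
    using a r B
    by (auto simp: kronecker_def stack_vec_def scalar_prod_def lessThan_atLeast0 less_mult_imp_div_less intro!: sum.cong)
  also have "\<dots> = (\<Sum>j<p. \<Sum>b<n. r $ j * B $$ (a, b) * v j $ b)"
    using a by (auto simp: sum_lessThan_mult intro!: sum.cong)
  also have "\<dots> = (\<Sum>b<n. \<Sum>j<p. B $$ (a, b) * (v j $ b * r $ j))"
    by (subst sum.swap) (simp add: mult_ac)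
  also have "\<dots> = (B *\<^sub>v (mat n p (\<lambda>(a, j). v j $ a) *\<^sub>v r)) $ a"
    using a r B by (simp add: scalar_prod_def lessThan_atLeast0 sum_distrib_left)
  finally show "(kronecker (mat_of_row r) B *\<^sub>v stack_vec p n v) $ a
      = (B *\<^sub>v (mat n p (\<lambda>(a, j). v j $ a) *\<^sub>v r)) $ a" .
qed (use B in \<open>simp add: kronecker_def\<close>)

text \<open>The power \<open>^\<^sub>m\<close> recurses by multiplication on the right, while the
  weighted mean evolves by multiplication on the left.\<close>

lemma pow_mat_Suc_left:
  fixes A :: "'a :: comm_ring_1 mat"
  assumes A: "A \<in> carrier_mat n n"
  shows "A ^\<^sub>m Suc k = A * A ^\<^sub>m k"
proof (induction k)
  case (Suc k)
  have "A ^\<^sub>m Suc (Suc k) = (A * A ^\<^sub>m k) * A" by (simp only: pow_mat.simps(2)[of A "Suc k"] Suc)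
  also have "\<dots> = A * A ^\<^sub>m Suc k" using A by (simp add: assoc_mult_mat[of _ n n _ n _ n])
  finally show ?case .
qed (use A in simp)

lemma eigenvalue_transpose:
  fixes A :: "'a :: field mat"
  assumes "A \<in> carrier_mat n n"
  shows "eigenvalue (A\<^sup>T) \<mu> \<longleftrightarrow> eigenvalue A \<mu>"
  using assms by (simp add: eigenvalue_root_char_poly[of _ n])

theorem theorem2:
  fixes n m p :: nat
    and A C L \<Lambda> :: "real mat"
    and r :: "real vec"
    and x u y z :: "nat \<Rightarrow> nat \<Rightarrow> real vec"
  assumes A: "A \<in> carrier_mat n n"
    and C: "C \<in> carrier_mat m n"
    and neutral: "neutrally_stable A"
    and detect: "detectable n m C A"
    and gain: "sync_gain n m A C L"
    and p: "p \<ge> 1"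
    and \<Lambda>: "\<Lambda> \<in> carrier_mat p p"
    and conn: "connected_matrix p \<Lambda>"
    and init: "\<And>i. i < p \<Longrightarrow> x i 0 \<in> carrier_vec n"
    and state: "\<And>i k. i < p \<Longrightarrow> x i (k + 1) = A *\<^sub>v x i k + u i k"
    and out: "\<And>i k. i < p \<Longrightarrow> y i k = C *\<^sub>v x i k"
    and input: "\<And>i k. i < p \<Longrightarrow> u i k = L *\<^sub>v z i k"
    and coupling: "\<And>i k. i < p \<Longrightarrow>
        z i k = finsum_vec TYPE(real) m (\<lambda>j. \<Lambda> $$ (i, j) \<cdot>\<^sub>v (y j k - y i k)) {..<p}"
    and r: "r \<in> carrier_vec p"
    and r_left: "mat_of_row r * \<Lambda> = mat_of_row r"
    and r_sum: "r \<bullet> ones_vec p = 1"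
  shows "\<forall>i<p. (\<lambda>k. norm2 (x i k -
           kronecker (mat_of_row r) (A ^\<^sub>m k) *\<^sub>v stack_vec p n (\<lambda>j. x j 0))) \<longlonglongrightarrow> 0"
proof (intro allI impI)
  have L: "L \<in> carrier_mat n m"
    and stable: "\<And>\<nu>. cmod \<nu> < 1 \<Longrightarrow> schur_stable (cmat (A - L * C) + \<nu> \<cdot>\<^sub>m cmat (L * C))"
    using coupled_mode_schur_stable[OF A C neutral detect gain, of 0]
      coupled_mode_schur_stable[OF A C neutral detect gain] by auto
  have x: "x i k \<in> carrier_vec n" if "i < p" for i k
  proof (induction k)
    case (Suc k)
    show ?case using state[OF that, of k] input[OF that, of k] L by (auto intro: carrier_vecI)
  qed (use init that in simp)
  have r_rows: "(\<Sum>i<p. r $ i * \<Lambda> $$ (i, j)) = r $ j" if "j < p" for j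
    using arg_cong[OF r_left, of "\<lambda>M. M $$ (0, j)"] that r \<Lambda>
    by (simp add: scalar_prod_def lessThan_atLeast0)
  have r_total: "(\<Sum>i<p. r $ i) = 1"
    using r_sum r by (simp add: scalar_prod_def ones_vec_def lessThan_atLeast0)
  have \<Lambda>_rows: "(\<Sum>j<p. \<Lambda> $$ (i, j)) = 1" if "i < p" for i using conn that by (simp add: connected_matrix_def)

  define B where "B = L * C"
  \<comment> \<open>The agents become the columns of one matrix, so that right multiplication by
    \<open>\<Lambda>\<^sup>T\<close> performs the averaging over neighbours.\<close>
  define X where "X k = mat n p (\<lambda>(a, i). x i k $ a)" for k
  have B: "B \<in> carrier_mat n n" and X: "\<And>k. X k \<in> carrier_mat n p" using L C by (auto simp: B_def X_def)
  have col_X: "col (X k) i = x i k" if "i < p" for i k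
    using x[OF that, of k] that by (intro eq_vecI) (auto simp: X_def)
  \<comment> \<open>Row sums equal to 1 collect the weighted differences into a weighted average
    minus the agent's own state.\<close>
  have z: "z i k = C *\<^sub>v (X k *\<^sub>v row \<Lambda> i - x i k)" if i: "i < p" for i k
  proof (rule eq_vecI)
    fix b assume "b < dim_vec (C *\<^sub>v (X k *\<^sub>v row \<Lambda> i - x i k))"
    then have b: "b < m" using C by simp
    have row: "row \<Lambda> i \<in> carrier_vec p" using \<Lambda> by (auto intro: carrier_vecI)
    have "z i k $ b = (\<Sum>j<p. \<Lambda> $$ (i, j) * ((C *\<^sub>v x j k) $ b - (C *\<^sub>v x i k) $ b))"
      unfolding coupling[OF i] using b C x i
      by (subst index_finsum_vec) (auto simp: out)
    also have "\<dots> = (\<Sum>j<p. \<Lambda> $$ (i, j) * (C *\<^sub>v x j k) $ b) - (C *\<^sub>v x i k) $ b"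
      using \<Lambda>_rows[OF i] by (simp add: right_diff_distrib sum_subtractf flip: sum_distrib_right)
    also have "(\<Sum>j<p. \<Lambda> $$ (i, j) * (C *\<^sub>v x j k) $ b) = ((C * X k) *\<^sub>v row \<Lambda> i) $ b"
    proof -
      have "((C * X k) *\<^sub>v row \<Lambda> i) $ b = (\<Sum>j = 0..<p. row (C * X k) b $ j * row \<Lambda> i $ j)"
        using b C X[of k] \<Lambda> i by (simp add: scalar_prod_def del: assoc_mult_mat_vec)
      also have "\<dots> = (\<Sum>j = 0..<p. (C *\<^sub>v x j k) $ b * \<Lambda> $$ (i, j))"
        using b C X[of k] \<Lambda> i by (intro sum.cong) (auto simp: col_X)
      finally show ?thesis by (simp add: lessThan_atLeast0 mult.commute)
    qed
    also have "(C * X k) *\<^sub>v row \<Lambda> i = C *\<^sub>v (X k *\<^sub>v row \<Lambda> i)"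
      by (rule assoc_mult_mat_vec[OF C X row])
    also have "\<dots> $ b - (C *\<^sub>v x i k) $ b = (C *\<^sub>v (X k *\<^sub>v row \<Lambda> i - x i k)) $ b"
      using mult_minus_distrib_mat_vec[OF C, of "X k *\<^sub>v row \<Lambda> i" "x i k"] X[of k] row x[OF i] b C by simp
    finally show "z i k $ b = (C *\<^sub>v (X k *\<^sub>v row \<Lambda> i - x i k)) $ b" .
  next
    have "z i k \<in> carrier_vec m" unfolding coupling[OF i]
      by (intro finsum_vec_closed) (use C in \<open>auto simp: out i intro!: carrier_vecI\<close>)
    then show "dim_vec (z i k) = dim_vec (C *\<^sub>v (X k *\<^sub>v row \<Lambda> i - x i k))" using C by simp
  qed
  have X_Suc: "X (Suc k) = A * X k + (B * (X k * \<Lambda>\<^sup>T) - B * X k)" for k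
  proof (rule eq_matI)
    fix a i assume "a < dim_row (A * X k + (B * (X k * \<Lambda>\<^sup>T) - B * X k))"
      "i < dim_col (A * X k + (B * (X k * \<Lambda>\<^sup>T) - B * X k))"
    then have a: "a < n" and i: "i < p" using B X[of k] by auto
    have row: "row \<Lambda> i \<in> carrier_vec p" using \<Lambda> by (auto intro: carrier_vecI)
    have Xr: "X k *\<^sub>v row \<Lambda> i \<in> carrier_vec n" using X[of k] row by simp
    have "u i k = B *\<^sub>v (X k *\<^sub>v row \<Lambda> i - x i k)"
      unfolding input[OF i] z[OF i] B_def using L C Xr x[OF i, of k]
      by (simp add: assoc_mult_mat_vec[of _ n m _ n])
    also have "\<dots> = B *\<^sub>v (X k *\<^sub>v row \<Lambda> i) - B *\<^sub>v x i k"
      by (rule mult_minus_distrib_mat_vec[OF B Xr x[OF i]])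
    finally have "x i (Suc k) = A *\<^sub>v x i k + (B *\<^sub>v (X k *\<^sub>v row \<Lambda> i) - B *\<^sub>v x i k)"
      using state[OF i, of k] by simp
    moreover have "col (B * (X k * \<Lambda>\<^sup>T)) i = B *\<^sub>v (X k *\<^sub>v row \<Lambda> i)"
    proof -
      have "col (X k * \<Lambda>\<^sup>T) i = X k *\<^sub>v col (\<Lambda>\<^sup>T) i"
        using X[of k] \<Lambda> i by (intro col_mult2[of _ n p _ p]) auto
      also have "col (\<Lambda>\<^sup>T) i = row \<Lambda> i" using \<Lambda> i by simp
      finally have "X k *\<^sub>v row \<Lambda> i = col (X k * \<Lambda>\<^sup>T) i" by simp
      then show ?thesis
        using B X[of k] \<Lambda> i by (simp only:) (intro col_mult2[of _ n n _ p], auto)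
    qed
    moreover have "col (A * X k) i = A *\<^sub>v x i k" "col (B * X k) i = B *\<^sub>v x i k"
      unfolding col_X[OF i, symmetric] by (rule col_mult2[OF A X i], rule col_mult2[OF B X i])
    ultimately have "x i (Suc k) = col (A * X k) i + (col (B * (X k * \<Lambda>\<^sup>T)) i - col (B * X k) i)" by simp
    then have "x i (Suc k) $ a = (col (A * X k) i + (col (B * (X k * \<Lambda>\<^sup>T)) i - col (B * X k) i)) $ a" by simp
    moreover have "X (Suc k) $$ (a, i) = x i (Suc k) $ a" using a i by (simp add: X_def)
    ultimately show "X (Suc k) $$ (a, i) = (A * X k + (B * (X k * \<Lambda>\<^sup>T) - B * X k)) $$ (a, i)"
      using a i A B X[of k] \<Lambda> by simp
  qed (use A B X[of k] X[of "Suc k"] in auto)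

  have "\<Lambda>\<^sup>T *\<^sub>v r = r"
    using \<Lambda> r r_rows by (intro eq_vecI) (auto simp: scalar_prod_def lessThan_atLeast0 mult.commute)
  \<comment> \<open>As \<open>r\<close> is fixed by \<open>\<Lambda>\<^sup>T\<close>, the coupling
    terms cancel in the weighted mean, which follows the uncoupled dynamics.\<close>
  then have "X (Suc k) *\<^sub>v r = A *\<^sub>v (X k *\<^sub>v r)" for k
  proof -
    have "(B * (X k * \<Lambda>\<^sup>T)) *\<^sub>v r = (B * X k) *\<^sub>v r"
      using B X[of k] \<Lambda> r \<open>\<Lambda>\<^sup>T *\<^sub>v r = r\<close>
      by (simp add: assoc_mult_mat_vec[of _ n n _ p] assoc_mult_mat_vec[of _ n p _ p])
    moreover have "X (Suc k) *\<^sub>v r = (A * X k) *\<^sub>v r + ((B * (X k * \<Lambda>\<^sup>T)) *\<^sub>v r - (B * X k) *\<^sub>v r)"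
      unfolding X_Suc using A B X[of k] \<Lambda> r
      by (subst add_mult_distrib_mat_vec[of _ n p]) (auto simp del: assoc_mult_mat_vec simp: minus_mult_distrib_mat_vec[of _ n p])
    moreover have "A *\<^sub>v w + (B *\<^sub>v w - B *\<^sub>v w) = A *\<^sub>v w" for w
      by (intro eq_vecI) (use A B in auto)
    ultimately show ?thesis using A B X[of k] r by (simp add: assoc_mult_mat_vec[of _ n n _ p])
  qed
  then have mean: "X k *\<^sub>v r = A ^\<^sub>m k *\<^sub>v (X 0 *\<^sub>v r)" for k
  proof (induction k)
    case (Suc k)
    have "A ^\<^sub>m Suc k = A * A ^\<^sub>m k" using pow_mat_Suc_left[OF A] .
    then show ?case
      using Suc A X[of 0] r by (simp add: assoc_mult_mat_vec[of _ n n _ n] del: pow_mat.simps)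
  qed (use A X[of 0] r in simp)

  \<comment> \<open>\<open>J\<close> is the product of the column \<open>r\<close> and the row of
    ones: every column of \<open>X k * J\<close> is the weighted mean, and the columns of
    \<open>E k\<close> are the synchronization errors.\<close>
  define J where "J = mat p p (\<lambda>(i, j). r $ i)"
  define E where "E k = X k - X k * J" for k
  define N where "N = \<Lambda>\<^sup>T - J"
  have J: "J \<in> carrier_mat p p" and N: "N \<in> carrier_mat p p" using \<Lambda> by (auto simp: J_def N_def)
  have E: "E k \<in> carrier_mat n p" for k using X[of k] J by (auto simp: E_def)
  \<comment> \<open>These three identities reduce \<open>E k * N\<close> to
    \<open>X k * \<Lambda>\<^sup>T - X k * J\<close>, which closes the recurrence in
    \<open>E\<close> alone.\<close>
  have J\<Lambda>: "J * \<Lambda>\<^sup>T = J"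
    using \<Lambda> \<Lambda>_rows by (intro eq_matI) (auto simp: J_def scalar_prod_def lessThan_atLeast0 simp flip: sum_distrib_left)
  have \<Lambda>J: "\<Lambda>\<^sup>T * J = J"
    using \<Lambda> r_rows by (intro eq_matI) (auto simp: J_def scalar_prod_def lessThan_atLeast0 mult.commute)
  have JJ: "J * J = J"
    using r_total by (intro eq_matI) (auto simp: J_def scalar_prod_def lessThan_atLeast0 simp flip: sum_distrib_left)
  have E_Suc: "E (Suc k) = (A - B) * E k + B * E k * N" for k
  proof -
    note c = A B X[of k] J \<Lambda> N
    have XJ: "X k * J \<in> carrier_mat n p" and X\<Lambda>: "X k * \<Lambda>\<^sup>T \<in> carrier_mat n p" using c by auto
    have AX: "A * X k \<in> carrier_mat n p" and BX: "B * X k \<in> carrier_mat n p"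
      and BX\<Lambda>: "B * (X k * \<Lambda>\<^sup>T) \<in> carrier_mat n p" using c X\<Lambda> by auto
    have "X (Suc k) * J = A * X k * J + (B * (X k * \<Lambda>\<^sup>T) * J - B * X k * J)"
      unfolding X_Suc
      by (simp only: add_mult_distrib_mat[OF AX minus_carrier_mat[OF BX] J] minus_mult_distrib_mat[OF BX\<Lambda> BX J])
    also have "A * X k * J = A * (X k * J)" using c by (simp add: assoc_mult_mat[of _ n n _ p _ p])
    also have "B * (X k * \<Lambda>\<^sup>T) * J = B * (X k * J)"
      using c \<Lambda>J by (simp add: assoc_mult_mat[of _ n n _ p _ p] assoc_mult_mat[of _ n p _ p _ p])
    also have "B * X k * J = B * (X k * J)" using c by (simp add: assoc_mult_mat[of _ n n _ p _ p])
    finally have 1: "E (Suc k) = (A * X k + (B * (X k * \<Lambda>\<^sup>T) - B * X k))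
        - (A * (X k * J) + (B * (X k * J) - B * (X k * J)))"
      unfolding E_def X_Suc by simp
    have "E k * N = (X k * \<Lambda>\<^sup>T - X k * J) - (X k * J * \<Lambda>\<^sup>T - X k * J * J)"
      using minus_mult_distrib_mat[OF X XJ minus_carrier_mat[OF J]] mult_minus_distrib_mat[OF X _ J]
        mult_minus_distrib_mat[OF XJ _ J] \<Lambda>
      by (simp add: E_def N_def del: assoc_mult_mat)
    also have "X k * J * \<Lambda>\<^sup>T - X k * J * J = X k * J - X k * J"
      using c J\<Lambda> JJ by (simp add: assoc_mult_mat[of _ n p _ p _ p])
    also have "(X k * \<Lambda>\<^sup>T - X k * J) - (X k * J - X k * J) = X k * \<Lambda>\<^sup>T - X k * J"
      using c X\<Lambda> XJ by (intro eq_matI) (auto simp del: index_mult_mat(1))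
    finally have "B * E k * N = B * (X k * \<Lambda>\<^sup>T) - B * (X k * J)"
      using assoc_mult_mat[OF B E N] mult_minus_distrib_mat[OF B X\<Lambda> XJ] by simp
    moreover have "(A - B) * E k = (A * X k - A * (X k * J)) - (B * X k - B * (X k * J))"
      using minus_mult_distrib_mat[OF A B E] mult_minus_distrib_mat[OF A X XJ] mult_minus_distrib_mat[OF B X XJ]
      by (simp add: E_def)
    ultimately have 2: "(A - B) * E k + B * E k * N
        = (A * X k - A * (X k * J)) - (B * X k - B * (X k * J)) + (B * (X k * \<Lambda>\<^sup>T) - B * (X k * J))" by simp
    have "A * X k \<in> carrier_mat n p" "A * (X k * J) \<in> carrier_mat n p" "B * X k \<in> carrier_mat n p"
      "B * (X k * J) \<in> carrier_mat n p" "B * (X k * \<Lambda>\<^sup>T) \<in> carrier_mat n p"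
      using c XJ X\<Lambda> by auto
    then show ?thesis unfolding 1 2 using c by (intro eq_matI) (auto simp del: index_mult_mat(1))
  qed

  have "J\<^sup>T = mat p p (\<lambda>(i, j). r $ j)" by (intro eq_matI) (auto simp: J_def)
  \<comment> \<open>Up to transposition, which preserves eigenvalues, \<open>N\<close> is the
    deflated connected matrix.\<close>
  then have N_eq: "cmat N = (cmat (\<Lambda> - mat p p (\<lambda>(i, j). r $ j)))\<^sup>T"
    using \<Lambda> by (intro eq_matI) (auto simp: N_def J_def)
  have N_ev: "cmod \<nu> < 1" if "eigenvalue (cmat N) \<nu>" for \<nu>
    using that connected_matrix_deflated_eigenvalue[OF \<Lambda> conn r_rows r_total]
      eigenvalue_transpose[of "cmat (\<Lambda> - mat p p (\<lambda>(i, j). r $ j))" p] \<Lambda>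
    by (simp add: N_eq minus_carrier_mat)

  fix i assume i: "i < p"
  show "(\<lambda>k. norm2 (x i k - kronecker (mat_of_row r) (A ^\<^sub>m k) *\<^sub>v stack_vec p n (\<lambda>j. x j 0))) \<longlonglongrightarrow> 0"
  proof (rule tendsto_norm2_0)
    have kron: "kronecker (mat_of_row r) (A ^\<^sub>m k) *\<^sub>v stack_vec p n (\<lambda>j. x j 0) = X k *\<^sub>v r" for k
      using kronecker_row_mult_stack_vec[where v = "\<lambda>j. x j 0", OF r pow_carrier_mat[OF A, of k]] init mean[of k]
      by (simp add: X_def)
    show "x i k - kronecker (mat_of_row r) (A ^\<^sub>m k) *\<^sub>v stack_vec p n (\<lambda>j. x j 0) \<in> carrier_vec n" for k
      unfolding kron using x[OF i] X[of k] by (auto intro: carrier_vecI)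
    fix a assume a: "a < n"
    \<comment> \<open>The errors are real, but the eigenvalues of \<open>N\<close> may be complex,
      so the limit is taken over the complex numbers and real parts are extracted
      afterwards.\<close>
    have "(\<lambda>k. cmat (E k) $$ (a, i)) \<longlonglongrightarrow> 0"
    proof (rule sylvester_recurrence_tendsto_0[where M = "cmat (A - B)" and B = "cmat B" and N = "cmat N"])
      show "schur_stable (cmat (A - B) + \<nu> \<cdot>\<^sub>m cmat B)" if "eigenvalue (cmat N) \<nu>" for \<nu>
        unfolding B_def using stable[OF N_ev[OF that]] .
      show "cmat (E (Suc k)) = cmat (A - B) * cmat (E k) + cmat B * cmat (E k) * cmat N" for k
      proof -
        have AB: "A - B \<in> carrier_mat n n" by (rule minus_carrier_mat[OF B])
        have BE: "B * E k \<in> carrier_mat n p" using B E[of k] by simp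
        have "cmat (E (Suc k)) = cmat ((A - B) * E k) + cmat (B * E k * N)"
          unfolding E_Suc using AB BE N E[of k] by (intro eq_matI) (auto simp del: index_mult_mat(1))
        then show ?thesis by (simp only: cmat_mult[OF AB E] cmat_mult[OF BE N] cmat_mult[OF B E])
      qed
    qed (use A B N E a i in \<open>auto intro: minus_carrier_mat\<close>)
    then have "(\<lambda>k. Re (cmat (E k) $$ (a, i))) \<longlonglongrightarrow> 0" using tendsto_Re by fastforce
    moreover have "Re (cmat (E k) $$ (a, i)) = E k $$ (a, i)" for k using a i E[of k] by simp
    ultimately have "(\<lambda>k. E k $$ (a, i)) \<longlonglongrightarrow> 0" by simp
    moreover have "E k $$ (a, i) = (x i k - X k *\<^sub>v r) $ a" for k
    proof -
      have "(X k * J) $$ (a, i) = (X k *\<^sub>v r) $ a"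
        using a i X[of k] r by (simp add: J_def scalar_prod_def)
      then show ?thesis using a i X[of k] J by (simp add: E_def X_def)
    qed
    ultimately show "(\<lambda>k. (x i k - kronecker (mat_of_row r) (A ^\<^sub>m k) *\<^sub>v stack_vec p n (\<lambda>j. x j 0)) $ a) \<longlonglongrightarrow> 0"
      unfolding kron by simp
  qed
qed

end
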